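(* Let $a=(a_n)_{n\ge 0}$ with $a_n>0$ and $b=(b_n)_{n\ge0}$ with $b_n\in\mathbb{R}$, let $(p_n)$ be the associated orthonormal polynomials, and let $N$ be a positive integer. Suppose that \[ \mathcal{V}_N\Big(\tfrac{1}{a_n}\Big)+\mathcal{V}_N\Big(\tfrac{b_n}{a_n}\Big)+\mathcal{V}_1\Big(\tfrac{a_{n+N}}{a_n}\Big)<\infty, \] and that (a) $\sum_{n=0}^\infty \frac{1}{a_n}=\infty$; (b) $\lim_{n\to\infty}\frac{1}{a_n}=0$, and for each $i\in\{0,1,\dots,N-1\}$ the limits $q_i=\lim_{n\to\infty}\frac{b_{nN+i}}{a_{nN+i}}$ and $r_i=\lim_{n\to\infty}\frac{a_{nN+i-1}}{a_{nN+i}}$ exist with $r_i>0$; and that the matrix \[ \mathcal{F}=\prod_{j=0}^{N-1}\begin{pmatrix}0&1\\-r_j&-q_j\end{pmatrix} \] satisfies $\operatorname{discr}\mathcal{F}<0$. Then for each $x\in\mathbb{R}$ the limit \[ g(x)=\lim_{n\to\infty}a_{n+N-1}D^N_n(x) \] exists, and $g$ is a continuous function on $\mathbb{R}$ without zeros. Moreover, the orthogonality measure $\mu$ (which is unique) is absolutely continuous on $\mathbb{R}$ with density \[ \mu'(x)=\frac{\sqrt{-\operatorname{discr}\mathcal{F}}}{2\pi|g(x)|},\qquad x\in\mathbb{R}. \]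
   Context: Given sequences $a_n>0$, $b_n\in\mathbb{R}$ ($n\ge0$), the orthonormal polynomials are defined by $p_{-1}=0$, $p_0=1$, and $a_{n-1}p_{n-1}(x)+b_np_n(x)+a_np_{n+1}(x)=xp_n(x)$ for $n\ge0$ (with any value of $a_{-1}$, as it multiplies $p_{-1}=0$). By Favard's theorem they are orthonormal in $L^2(\mu)$ for a Borel probability measure $\mu$ on $\mathbb{R}$ (the orthogonality measure). The $N$-shifted Turán determinant is $D^N_n(x)=p_n(x)p_{n+N-1}(x)-p_{n-1}(x)p_{n+N}(x)$. The total $N$-variation of a sequence $(x_n)_{n\ge0}$ is $\mathcal{V}_N(x_n)=\sum_{n=0}^\infty|x_{n+N}-x_n|$. For $X\in M_2(\mathbb{R})$, $\operatorname{discr}X=(\operatorname{tr}X)^2-4\det X$. Ordered products of matrices are taken with later indices on the left: $\prod_{k=n_0}^{n_1}C_k=C_{n_1}C_{n_1-1}\cdots C_{n_0}$ (identity if $n_1<n_0$). *)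

theory Defs
  imports "HOL-Probability.Probability"
begin

text \<open>Orthonormal polynomials: p_{-1} = 0, p_0 = 1,
  a_{n-1} p_{n-1} + b_n p_n + a_n p_{n+1} = x p_n.\<close>
fun orthp :: "(nat \<Rightarrow> real) \<Rightarrow> (nat \<Rightarrow> real) \<Rightarrow> nat \<Rightarrow> real \<Rightarrow> real" where
  "orthp a b 0 x = 1"
| "orthp a b (Suc 0) x = (x - b 0) / a 0"
| "orthp a b (Suc (Suc n)) x =
     ((x - b (Suc n)) * orthp a b (Suc n) x - a n * orthp a b n x) / a (Suc n)"

definition orthp_prev :: "(nat \<Rightarrow> real) \<Rightarrow> (nat \<Rightarrow> real) \<Rightarrow> nat \<Rightarrow> real \<Rightarrow> real" where
  "orthp_prev a b n x = (if n = 0 then 0 else orthp a b (n - 1) x)"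

definition turan :: "(nat \<Rightarrow> real) \<Rightarrow> (nat \<Rightarrow> real) \<Rightarrow> nat \<Rightarrow> nat \<Rightarrow> real \<Rightarrow> real" where
  "turan a b N n x = orthp a b n x * orthp a b (n + N - 1) x
                     - orthp_prev a b n x * orthp a b (n + N) x"

definition finite_var :: "nat \<Rightarrow> (nat \<Rightarrow> real) \<Rightarrow> bool" where
  "finite_var N x \<longleftrightarrow> summable (\<lambda>n. \<bar>x (n + N) - x n\<bar>)"

fun ordprod :: "(nat \<Rightarrow> real^2^2) \<Rightarrow> nat \<Rightarrow> real^2^2" where
  "ordprod C 0 = mat 1"
| "ordprod C (Suc n) = C n ** ordprod C n"

definition discr :: "real^2^2 \<Rightarrow> real" where
  "discr X = (trace X)^2 - 4 * det X"

definition transfer_mat :: "real \<Rightarrow> real \<Rightarrow> real^2^2" where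
  "transfer_mat r q = vector [vector [0, 1], vector [- r, - q]]"

definition is_orth_measure :: "(nat \<Rightarrow> real) \<Rightarrow> (nat \<Rightarrow> real) \<Rightarrow> real measure \<Rightarrow> bool" where
  "is_orth_measure a b \<mu> \<longleftrightarrow> prob_space \<mu> \<and> sets \<mu> = sets borel \<and>
     (\<forall>n m. integrable \<mu> (\<lambda>x. orthp a b n x * orthp a b m x) \<and>
            (\<integral>x. orthp a b n x * orthp a b m x \<partial>\<mu>) = (if n = m then 1 else 0))"

end

theory Submission
  imports Defs "HOL-Complex_Analysis.Cauchy_Integral_Theorem" "HOL-Real_Asymp.Real_Asymp"
begin

text \<open>
  Write \<open>v_n = (p_{n-1}, p_n)\<close>. The shifted Turan determinant is \<open>D_n = det (v_{n+N}, v_n)\<close>, a quadratic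
  form in \<open>v_n\<close> whose coefficients converge, along \<open>n = kN\<close>, to those of the form \<open>det (F v, v)\<close>, and the
  latter is definite because \<open>discr F < 0\<close>. Hence \<open>|D_n|\<close> dominates \<open>|v_n|^2\<close>, and the bounded variation
  hypotheses turn into \<open>S_{n+1} = S_n (1 + O(e_n))\<close> for \<open>S_n = a_{n+N-1} D_n\<close> with \<open>e_n\<close> summable, locally
  uniformly in \<open>x\<close>; so \<open>S_n\<close> converges to a continuous function without zeros.

  For \<open>Im t > 0\<close> Carmona's measure with density \<open>Im t / (pi a_{n-1} |p_n - t p_{n-1}|^2)\<close> has
  \<open>p_0, ..., p_{n-1}\<close> as orthonormal polynomials. Choosing for \<open>t\<close> the root of the limit form makes this
  density equal to \<open>sqrt (- discr F) / (2 pi a_{n-1} |det (F v_n, v_n)|)\<close>, which converges to the claimed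
  density; the relations pass to the limit since the tails are controlled by higher moments.

  Uniqueness: the coefficients \<open>c_n\<close> of \<open>1 / (x - z)\<close> are square summable by Bessel, and the difference
  \<open>d_n\<close> of those of two orthogonality measures solves the homogeneous recurrence. Constancy of the Wronskian
  gives \<open>d_0 = a_n (d_n c_{n+1} - d_{n+1} c_n)\<close>, so \<open>d_0 \<noteq> 0\<close> would force the sum of \<open>1 / a_n\<close> to converge.
  The measure is then recovered from its Cauchy transform by Stieltjes inversion.
\<close>

subsection \<open>Integrals along the real line\<close>

text \<open>If the coefficients were N-periodic, v_n and v_{n+N} would move to the next index by the
  same transfer matrix, and D_n would only be multiplied by its determinant a_{n-1} / a_n. The
  N-variations measure the failure of this. The factor a_{n+N-1} in S_n turns that determinant into
  c_n / c_{n-1} with c_n = a_{n+N} / a_n, whose distance to 1 is summable by the third variation.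
  The remaining error is quadratic in v_n, for which no a priori bound is at hand; definiteness
  turns it into an error relative to S_n itself. That c_n tends to 1 has to be derived: a limit
  below 1 contradicts 1 / a_n -> 0, a limit above 1 contradicts the divergence of the sum of 1 /
  a_n. It enters because Carmona's density carries a_m where S carries a_{m+N}. Existence of an
  orthogonality measure comes from the limit of Carmona's measures rather than from Favard's
  theorem, so existence and density are obtained together.\<close>

lemma lower_half_plane_integral_tendsto:
  fixes h :: "complex \<Rightarrow> complex"
  assumes diff: "\<And>z. Im z \<le> 0 \<Longrightarrow> h field_differentiable at z"
    and lim: "((\<lambda>z. z * h z) \<longlongrightarrow> L) at_infinity"
  shows "((\<lambda>R. integral {-R..R} (\<lambda>x. h (of_real x))) \<longlongrightarrow> \<i> * pi * L) at_top"
proof -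
  have cont: "continuous_on {z. Im z \<le> 0} h"
    using diff by (auto intro!: continuous_at_imp_continuous_on field_differentiable_imp_continuous_at)
  \<comment> \<open>Segment and arc both run from -R to R inside the closed lower half plane, where
    \<open>h\<close> is holomorphic, so Cauchy's theorem exchanges them. On the arc dz = i z dt,
    which produces the factor z h(z) whose limit is known.\<close>
  have eq: "integral {-R..R} (\<lambda>x. h (of_real x)) =
      integral {-pi..0} (\<lambda>t. h (R * cis t) * R * \<i> * cis t)" 
    and int: "(\<lambda>t. h (R * cis t) * R * \<i> * cis t) integrable_on {-pi..0}" if "R > 0" for R :: real
  proof -
    let ?c = "part_circlepath 0 R (-pi) 0" and ?l = "linepath (of_real (-R)) (of_real R) :: real \<Rightarrow> complex"
    have imc: "path_image ?c \<subseteq> {z. Im z \<le> 0}"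
      using that by (auto simp: path_image_part_circlepath Im_exp closed_segment_eq_real_ivl mult_le_0_iff
          sin_ge_zero sin_le_zero split: if_splits)
        (metis add.inverse_inverse neg_0_le_iff_le neg_le_iff_le sin_ge_zero sin_minus)
    have iml: "path_image ?l \<subseteq> {z. Im z \<le> 0}"
      by (auto simp: closed_segment_def)
    have ends: "pathstart ?c = -R" "pathfinish ?c = R"
      by (simp_all add: complex_eq_iff Re_exp Im_exp)
    have ic: "h contour_integrable_on ?c"
      by (rule contour_integrable_continuous_part_circlepath) (rule continuous_on_subset[OF cont imc])
    have il: "h contour_integrable_on ?l"
      by (rule contour_integrable_continuous_linepath) (use continuous_on_subset[OF cont iml] in simp)
    have "(h has_contour_integral 0) (?l +++ reversepath ?c)"
    proof (rule Cauchy_theorem_convex[OF cont])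
      show "convex {z. Im z \<le> 0}" by (rule convex_halfspace_Im_le)
    next
      fix z assume "z \<in> interior {z. Im z \<le> 0} - {}"
      then show "h field_differentiable at z" using diff interior_subset by blast
    next
      show "path_image (?l +++ reversepath ?c) \<subseteq> {z. Im z \<le> 0}"
        using imc iml path_image_join_subset[of ?l "reversepath ?c"] path_image_reversepath[of ?c]
        by blast
    qed (use ends in auto)
    then have "contour_integral (?l +++ reversepath ?c) h = 0"
      by (rule contour_integral_unique)
    moreover have "contour_integral (?l +++ reversepath ?c) h =
        contour_integral ?l h + contour_integral (reversepath ?c) h"
      using ic il by (intro contour_integral_join contour_integrable_reversepath) auto
    moreover have "contour_integral (reversepath ?c) h = - contour_integral ?c h"
      by (intro contour_integral_reversepath) auto
    ultimately have "contour_integral ?l h = contour_integral ?c h" by simp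
    moreover have "contour_integral ?l h = integral {-R..R} (\<lambda>x. h (of_real x))"
      using that by (subst contour_integral_linepath_Reals_eq) auto
    moreover have 1: "(h has_contour_integral contour_integral ?c h) ?c"
      using ic by (rule has_contour_integral_integral)
    then have 2: "((\<lambda>t. h (R * cis t) * R * \<i> * cis t) has_integral contour_integral ?c h) {-pi..0}"
      by (subst (asm) has_contour_integral_part_circlepath_iff) auto
    ultimately show "integral {-R..R} (\<lambda>x. h (of_real x)) =
      integral {-pi..0} (\<lambda>t. h (R * cis t) * R * \<i> * cis t)"
      by (simp add: integral_unique)
    show "(\<lambda>t. h (R * cis t) * R * \<i> * cis t) integrable_on {-pi..0}" using 2 by blast
  qed
  show ?thesis
  proof (rule tendstoI)
    fix e :: real assume e: "e > 0"
    \<comment> \<open>The arc has angular length pi < 4.\<close>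
    define d where "d = e / 4"
    have d: "d > 0" using e by (simp add: d_def)
    from lim d obtain B where B: "\<And>z. norm z \<ge> B \<Longrightarrow> dist (z * h z) L < d"
      unfolding Lim_at_infinity by blast
    have "dist (integral {-R..R} (\<lambda>x. h (of_real x))) (\<i> * pi * L) < e" if R: "R > max B 1" for R
    proof -
      have R0: "R > 0" using R by auto
      have c: "((\<lambda>t::real. \<i> * L) has_integral (\<i> * pi * L)) {-pi..0}"
        using has_integral_const_real[of "\<i> * L" "-pi" 0] by (simp add: scaleR_conv_of_real mult_ac)
      have "((\<lambda>t. h (R * cis t) * R * \<i> * cis t - \<i> * L) has_integral
         (integral {-R..R} (\<lambda>x. h (of_real x)) - \<i> * pi * L)) (cbox (-pi) 0)"
        unfolding eq[OF R0] box_real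
        by (intro has_integral_diff integrable_integral int[OF R0] c)
      then have "norm (integral {-R..R} (\<lambda>x. h (of_real x)) - \<i> * pi * L) \<le> d * measure lborel (cbox (-pi) 0)"
      proof (rule has_integral_bound[rotated])
        fix t assume "t \<in> cbox (-pi) 0"
        have "norm (R * cis t) \<ge> B" using R by (simp add: norm_mult)
        then have "norm ((R * cis t) * h (R * cis t) - L) \<le> d"
          using B[of "R * cis t"] by (simp add: dist_norm)
        moreover have "h (R * cis t) * R * \<i> * cis t - \<i> * L = \<i> * ((R * cis t) * h (R * cis t) - L)"
          by (simp add: algebra_simps)
        ultimately show "norm (h (R * cis t) * R * \<i> * cis t - \<i> * L) \<le> d"
          by (simp add: norm_mult)
      qed (use d in simp)
      also have "\<dots> < e" using pi_less_4 e by (simp add: d_def)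
      finally show ?thesis by (simp add: dist_norm)
    qed
    then show "\<forall>\<^sub>F R in at_top. dist (integral {-R..R} (\<lambda>x. h (of_real x))) (\<i> * pi * L) < e"
      unfolding eventually_at_top_dense by blast
  qed
qed

lemma continuous_tendsto_at_infinity_bounded:
  fixes f :: "real \<Rightarrow> real"
  assumes "continuous_on UNIV f" "(f \<longlongrightarrow> L) at_infinity"
  obtains C where "\<And>x. \<bar>f x\<bar> \<le> C"
proof -
  from assms(2) obtain B where B: "\<And>x. \<bar>x\<bar> \<ge> B \<Longrightarrow> dist (f x) L < 1"
    unfolding Lim_at_infinity by (metis real_norm_def zero_less_one)
  have "compact (f ` {-\<bar>B\<bar>..\<bar>B\<bar>})"
    by (intro compact_continuous_image continuous_on_subset[OF assms(1)]) auto
  then obtain C where C: "\<And>x. x \<in> {-\<bar>B\<bar>..\<bar>B\<bar>} \<Longrightarrow> \<bar>f x\<bar> \<le> C"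
    by (metis bounded_iff compact_imp_bounded imageI real_norm_def)
  have "\<bar>f x\<bar> \<le> max C (\<bar>L\<bar> + 1)" for x
    using B[of x] C[of x] unfolding dist_real_def atLeastAtMost_iff by linarith
  then show ?thesis using that by blast
qed

lemma integrable_of_tendsto_at_infinity:
  fixes f :: "real \<Rightarrow> real"
  assumes cont: "continuous_on UNIV f" and lim: "((\<lambda>x. f x * (1 + x\<^sup>2)) \<longlongrightarrow> L) at_infinity"
  shows "integrable lborel f"
proof -
  have "continuous_on UNIV (\<lambda>x. f x * (1 + x\<^sup>2))"
    by (intro continuous_intros cont)
  from continuous_tendsto_at_infinity_bounded[OF this lim]
  obtain C where C: "\<And>x. \<bar>f x * (1 + x\<^sup>2)\<bar> \<le> C" by blast
  have pos: "1 + x\<^sup>2 > 0" for x :: real by (simp add: add_pos_nonneg)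
  show ?thesis
  proof (rule Bochner_Integration.integrable_bound)
    show "integrable lborel (\<lambda>x. C * inverse (1 + x\<^sup>2))"
      using integrable_inverse_1_plus_square by (auto simp: set_integrable_def)
    show "f \<in> borel_measurable lborel"
      using borel_measurable_continuous_onI[OF cont] by simp
    show "AE x in lborel. norm (f x) \<le> norm (C * inverse (1 + x\<^sup>2))"
    proof (rule AE_I2)
      fix x
      have "\<bar>f x\<bar> * (1 + x\<^sup>2) \<le> C" using C[of x] pos[of x] by (simp add: abs_mult)
      then have "\<bar>f x\<bar> \<le> C * inverse (1 + x\<^sup>2)"
        using pos[of x] by (simp add: field_simps)
      then show "norm (f x) \<le> norm (C * inverse (1 + x\<^sup>2))" by simp
    qed
  qed
qed

subsection \<open>Orthonormal polynomials in the complex plane\<close>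

lemma one_over_at_infinity: "((\<lambda>z. 1 / z) \<longlongrightarrow> 0) (at_infinity :: 'a :: real_normed_field filter)"
  using tendsto_inverse_0 by (simp add: divide_inverse)

lemma eventually_nonzero_at_infinity: "\<forall>\<^sub>F z :: 'a :: real_normed_vector in at_infinity. z \<noteq> 0"
  unfolding eventually_at_infinity by (rule exI[of _ 1]) auto

lemma of_real_at_infinity: "filterlim (of_real :: real \<Rightarrow> complex) at_infinity at_infinity"
  by (rule filterlim_norm_at_top_imp_at_infinity) (simp add: filterlim_norm_at_top flip: real_norm_def)

text \<open>The contour argument evaluates the polynomials off the real axis, where
  \<open>orthp\<close> is not typed; the coefficients stay real.\<close>

fun corthp :: "(nat \<Rightarrow> real) \<Rightarrow> (nat \<Rightarrow> real) \<Rightarrow> nat \<Rightarrow> complex \<Rightarrow> complex" where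
  "corthp a b 0 z = 1"
| "corthp a b (Suc 0) z = (z - of_real (b 0)) / of_real (a 0)"
| "corthp a b (Suc (Suc n)) z =
     ((z - of_real (b (Suc n))) * corthp a b (Suc n) z - of_real (a n) * corthp a b n z) / of_real (a (Suc n))"

lemma corthp_of_real: "corthp a b n (of_real x) = of_real (orthp a b n x)"
  by (induction a b n x rule: orthp.induct) simp_all

lemma continuous_on_orthp [continuous_intros]:
  "continuous_on A f \<Longrightarrow> continuous_on A (\<lambda>x. orthp a b n (f x))"
proof -
  have "continuous_on UNIV (orthp a b n)"
  proof (induction n rule: induct_nat_012)
    case 0 then show ?case by (simp cong: continuous_on_cong)
  next
    case 1 
    have "orthp a b (Suc 0) = (\<lambda>x. (x - b 0) / a 0)" by auto
    then show ?case by (auto simp: divide_inverse intro!: continuous_intros)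
  next
    case (ge2 n)
    have "orthp a b (Suc (Suc n)) =
      (\<lambda>x. ((x - b (Suc n)) * orthp a b (Suc n) x - a n * orthp a b n x) / a (Suc n))" by auto
    with ge2 show ?case by (auto simp: divide_inverse intro!: continuous_intros)
  qed
  then show "continuous_on A f \<Longrightarrow> continuous_on A (\<lambda>x. orthp a b n (f x))"
    using continuous_on_compose2 by blast
qed

lemma borel_measurable_orthp [measurable]: "orthp a b n \<in> borel_measurable borel"
  by (intro borel_measurable_continuous_onI continuous_intros)

lemma corthp_field_differentiable: "corthp a b n field_differentiable at z"
proof (induction n rule: induct_nat_012)
  case 0 
  have "corthp a b 0 = (\<lambda>_. 1)" by auto
  then show ?case by simp
next
  case 1
  have "corthp a b (Suc 0) = (\<lambda>z. (z - of_real (b 0)) * inverse (of_real (a 0)))"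
    by (auto simp: divide_inverse)
  then show ?case by (auto intro!: derivative_intros)
next
  case (ge2 n)
  have "corthp a b (Suc (Suc n)) =
      (\<lambda>z. ((z - of_real (b (Suc n))) * corthp a b (Suc n) z - of_real (a n) * corthp a b n z) * inverse (of_real (a (Suc n))))"
    by (auto simp: divide_inverse)
  with ge2 show ?case by (auto intro!: derivative_intros)
qed

locale jacobi =
  fixes a b :: "nat \<Rightarrow> real"
  assumes a_pos: "a n > 0"
begin

abbreviation "p \<equiv> orthp a b"
abbreviation "pm \<equiv> orthp_prev a b"
abbreviation "P \<equiv> corthp a b"

lemma a_nz [simp]: "a n \<noteq> 0" using a_pos[of n] by simp

lemma pm_simps [simp]: "pm 0 x = 0" "pm (Suc n) x = p n x"
  by (simp_all add: orthp_prev_def)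

lemma p_rec: "x * p n x = a (n - 1) * pm n x + b n * p n x + a n * p (Suc n) x"
  by (cases n) (simp_all add: field_simps)

text \<open>In the recurrence the minus sign in front of \<open>a n\<close> and the conjugation of
  the previous product cancel, so both contributions to the imaginary part are nonpositive. The
  product stands for the ratio P_{n+1} / P_n and keeps its meaning where \<open>P n\<close>
  vanishes.\<close>

lemma Im_P_ratio_le_0:
  assumes "Im z \<le> 0"
  shows "Im (P (Suc n) z * cnj (P n z)) \<le> 0"
proof (induction n)
  case 0
  then show ?case using assms a_pos[of 0] by (simp add: divide_le_0_iff)
next
  case (Suc n)
  have "P (Suc (Suc n)) z * cnj (P (Suc n) z) =
    ((z - b (Suc n)) * (norm (P (Suc n) z))\<^sup>2 - of_real (a n) * cnj (P (Suc n) z * cnj (P n z))) / of_real (a (Suc n))"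
    unfolding complex_norm_square by (simp add: field_simps)
  then have "Im (P (Suc (Suc n)) z * cnj (P (Suc n) z)) =
     (Im z * (norm (P (Suc n) z))\<^sup>2 + a n * Im (P (Suc n) z * cnj (P n z))) / a (Suc n)"
    by (simp del: corthp.simps add: algebra_simps)
  also have "\<dots> \<le> 0"
    using assms Suc a_pos[of n] a_pos[of "Suc n"]
    by (intro divide_nonpos_pos add_nonpos_nonpos mult_nonpos_nonneg mult_nonneg_nonpos) auto
  finally show ?case .
qed

lemma P_not_both_zero: "P n z \<noteq> 0 \<or> P (Suc n) z \<noteq> 0"
proof (induction n)
  case (Suc n)
  then show ?case by auto
qed simp

text \<open>At a zero, \<open>P (Suc n) z * cnj (P n z)\<close> would be \<tau> |P_n|^2, which lies
  in the open upper half plane unless \<open>P n z\<close>, and with it \<open>P (Suc n) z\<close>,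
  vanishes.\<close>

lemma P_minus_tau_nz:
  assumes "Im z \<le> 0" "Im \<tau> > 0"
  shows "P (Suc n) z - \<tau> * P n z \<noteq> 0"
proof
  assume "P (Suc n) z - \<tau> * P n z = 0"
  then have eq: "P (Suc n) z = \<tau> * P n z" by simp
  then have "P (Suc n) z * cnj (P n z) = \<tau> * (norm (P n z))\<^sup>2"
    unfolding complex_norm_square by simp
  then have "Im \<tau> * (norm (P n z))\<^sup>2 \<le> 0"
    using Im_P_ratio_le_0[OF assms(1), of n] by simp
  then have "P n z = 0" using assms(2) by (simp add: mult_le_0_iff)
  then show False using eq P_not_both_zero[of n z] by simp
qed

text \<open>The leading coefficient of \<open>p n\<close>.\<close>

definition \<kappa> :: "nat \<Rightarrow> real" where "\<kappa> n = (\<Prod>k<n. 1 / a k)"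

lemma \<kappa>_pos: "\<kappa> n > 0"
  unfolding \<kappa>_def using a_pos by (intro prod_pos) auto

lemma P_asymp: "((\<lambda>z. P n z / z ^ n) \<longlongrightarrow> of_real (\<kappa> n)) at_infinity"
proof -
  show ?thesis
  proof (induction n rule: induct_nat_012)
    case 0
    then show ?case by (simp add: \<kappa>_def)
  next
    case 1
    have "((\<lambda>z. (1 - of_real (b 0) * (1 / z)) / of_real (a 0)) \<longlongrightarrow> (1 - of_real (b 0) * 0) / complex_of_real (a 0)) at_infinity"
      by (intro tendsto_intros one_over_at_infinity) simp
    also have "(1 - of_real (b 0) * 0) / complex_of_real (a 0) = of_real (\<kappa> (Suc 0))"
      by (simp add: \<kappa>_def)
    finally show ?case
    proof (rule Lim_transform_eventually)
      show "\<forall>\<^sub>F z in at_infinity. (1 - of_real (b 0) * (1 / z)) / of_real (a 0) = P (Suc 0) z / z ^ Suc 0"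
        using eventually_nonzero_at_infinity by eventually_elim (simp add: field_simps)
    qed
  next
    case (ge2 n)
    have "((\<lambda>z. ((1 - of_real (b (Suc n)) * (1 / z)) * (P (Suc n) z / z ^ Suc n)
            - of_real (a n) * (1/z)^2 * (P n z / z ^ n)) / of_real (a (Suc n))) \<longlongrightarrow>
        ((1 - of_real (b (Suc n)) * 0) * of_real (\<kappa> (Suc n)) - of_real (a n) * 0^2 * of_real (\<kappa> n)) / complex_of_real (a (Suc n))) at_infinity"
      by (intro tendsto_intros one_over_at_infinity ge2) simp
    also have "((1 - of_real (b (Suc n)) * 0) * of_real (\<kappa> (Suc n)) - of_real (a n) * 0^2 * of_real (\<kappa> n)) / complex_of_real (a (Suc n)) = of_real (\<kappa> (Suc (Suc n)))"
      by (simp add: \<kappa>_def)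
    finally show ?case
    proof (rule Lim_transform_eventually)
      show "\<forall>\<^sub>F z in at_infinity. ((1 - of_real (b (Suc n)) * (1 / z)) * (P (Suc n) z / z ^ Suc n)
            - of_real (a n) * (1/z)^2 * (P n z / z ^ n)) / of_real (a (Suc n)) = P (Suc (Suc n)) z / z ^ Suc (Suc n)"
        using eventually_nonzero_at_infinity by eventually_elim (simp add: field_simps power2_eq_square)
    qed
  qed
qed

end

subsection \<open>Carmona's approximating measures\<close>

text \<open>Links the gauge integrals over [-R, R] from the contour argument to the Lebesgue
  integral over the line.\<close>

lemma integral_symmetric_tendsto:
  fixes f :: "real \<Rightarrow> real"
  assumes "integrable lborel f"
  shows "((\<lambda>R. integral {-R..R} f) \<longlongrightarrow> (\<integral>x. f x \<partial>lborel)) at_top"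
proof (rule tendsto_at_topI_sequentially)
  fix X :: "nat \<Rightarrow> real" assume X: "filterlim X at_top sequentially"
  have "(\<lambda>n. \<integral>x. indicator {-X n..X n} x *\<^sub>R f x \<partial>lborel) \<longlonglongrightarrow> (\<integral>x. f x \<partial>lborel)"
  proof (rule integral_dominated_convergence)
    show "integrable lborel (\<lambda>x. norm (f x))" using assms by simp
    show "AE x in lborel. (\<lambda>n. indicator {-X n..X n} x *\<^sub>R f x) \<longlonglongrightarrow> f x"
    proof (rule AE_I2, rule tendsto_eventually)
      fix x
      have "\<forall>\<^sub>F n in sequentially. X n \<ge> \<bar>x\<bar>"
        using X unfolding filterlim_at_top by blast
      then show "\<forall>\<^sub>F n in sequentially. indicator {-X n..X n} x *\<^sub>R f x = f x"
        by eventually_elim (auto simp: indicator_def)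
    qed
  qed (use assms in \<open>auto simp: indicator_def\<close>)
  moreover have "(\<integral>x. indicator {-X n..X n} x *\<^sub>R f x \<partial>lborel) = integral {-X n..X n} f" for n
    using set_borel_integral_eq_integral(2)[of "{-X n..X n}" f] integrable_mult_indicator[OF _ assms, of "{-X n..X n}"]
    by (simp add: set_integrable_def set_lebesgue_integral_def)
  ultimately show "(\<lambda>n. integral {-X n..X n} f) \<longlonglongrightarrow> (\<integral>x. f x \<partial>lborel)" by simp
qed

context jacobi
begin

text \<open>Downward induction: multiplication by \<open>x\<close> is symmetric and tridiagonal, so orthonormality at the top
  index propagates to all lower ones.\<close>

lemma gram_matrix_eq:
  fixes G :: "nat \<Rightarrow> nat \<Rightarrow> real"
  assumes sym: "\<And>i j. G i j = G j i"
    and rel: "\<And>i j. i + j < 2 * m \<Longrightarrow>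
      (if i = 0 then 0 else a (i-1) * G (i-1) j) + b i * G i j + a i * G (Suc i) j =
      (if j = 0 then 0 else a (j-1) * G i (j-1)) + b j * G i j + a j * G i (Suc j)"
    and top: "\<And>j. j < m \<Longrightarrow> G m j = 0" "\<And>j. j < m \<Longrightarrow> G (Suc m) j = 0" "G m m = 1"
    and ij: "i \<le> m" "j \<le> m"
  shows "G i j = of_bool (i = j)"
proof -
  \<comment> \<open>Two consecutive rows are carried along because solving the recurrence for row k
    involves rows k + 1 and k + 2. For j < k the other side of \<open>rel\<close> meets row k + 1 at
    columns up to j + 1, still below the diagonal.\<close>
  have Z: "(\<forall>j<k. G k j = 0) \<and> (\<forall>j<k. G (Suc k) j = 0)" if "k \<le> m" for k
    using that
  proof (induction rule: inc_induct)
    case base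
    then show ?case using top by auto
  next
    case (step k)
    have "G k j = 0" if "j < k" for j
    proof -
      have "a k * G k j = 0"
        using rel[of "Suc k" j] step that by (auto split: if_splits)
      then show ?thesis by simp
    qed
    then show ?case using step by auto
  qed
  have N: "G k k = 1" if "k \<le> m" for k
    using that
  proof (induction rule: inc_induct)
    case base
    then show ?case using top by auto
  next
    case (step k)
    have z: "G (Suc k) k = 0" "G (Suc (Suc k)) k = 0" using Z[of "Suc k"] step by auto
    have z2: "G (Suc k) (k - 1) = 0" if "k > 0"
      using Z[of "Suc k"] step that by auto
    have "a k * G k k = a k"
      using rel[of "Suc k" k] step z z2 by (auto split: if_splits)
    then show ?case by simp
  qed
  show ?thesis
    using Z[of i] Z[of j] N[of i] sym[of i j] ij by (cases i j rule: linorder_cases) auto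
qed

context
  fixes m :: nat and \<tau> :: complex
  assumes \<tau>: "Im \<tau> > 0"
begin

definition Etau :: "complex \<Rightarrow> complex" where
  "Etau z = P (Suc m) z - \<tau> * P m z"

text \<open>The index n of the overview is \<open>Suc m\<close> here. Im \<tau> / |E|^2 is the shape
  in which Im (u / E) appears (see \<open>Im_div_Etau\<close>), and pi \<open>a m\<close> is the
  value of the contour integral for j = m, so it normalises the mass.\<close>

definition carmona_density :: "real \<Rightarrow> real" where
  "carmona_density x = Im \<tau> / (pi * a m * (norm (of_real (p (Suc m) x) - \<tau> * of_real (p m x)))\<^sup>2)"

lemma Etau_nz: "Im z \<le> 0 \<Longrightarrow> Etau z \<noteq> 0"
  unfolding Etau_def using P_minus_tau_nz \<tau> by blast

lemma Etau_of_real: "Etau (of_real x) = of_real (p (Suc m) x) - \<tau> * of_real (p m x)"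
  unfolding Etau_def corthp_of_real ..

lemma Etau_asymp: "((\<lambda>z. Etau z / z ^ Suc m) \<longlongrightarrow> of_real (\<kappa> (Suc m))) at_infinity"
proof -
  have "((\<lambda>z. P (Suc m) z / z ^ Suc m - \<tau> * (1 / z) * (P m z / z ^ m)) \<longlongrightarrow>
      of_real (\<kappa> (Suc m)) - \<tau> * 0 * of_real (\<kappa> m)) at_infinity"
    by (intro tendsto_intros one_over_at_infinity P_asymp)
  then show ?thesis by (simp add: Etau_def diff_divide_distrib mult_ac del: corthp.simps)
qed

text \<open>\<open>Etau\<close> has degree m + 1, so only j = m survives after multiplication by z,
  and the quotient of leading coefficients \<kappa>_m / \<kappa>_{m+1} is
  \<open>a m\<close>.\<close>

lemma P_div_Etau_asymp:
  assumes "j \<le> m"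
  shows "((\<lambda>z. z * (P j z / Etau z)) \<longlongrightarrow> (if j = m then of_real (a m) else 0)) at_infinity"
proof -
  have "((\<lambda>z. (P j z / z ^ j) * (1 / z) ^ (m - j) / (Etau z / z ^ Suc m)) \<longlongrightarrow>
      of_real (\<kappa> j) * 0 ^ (m - j) / of_real (\<kappa> (Suc m))) at_infinity"
    using \<kappa>_pos[of "Suc m"] by (intro tendsto_intros one_over_at_infinity P_asymp Etau_asymp) auto
  also have "of_real (\<kappa> j) * 0 ^ (m - j) / of_real (\<kappa> (Suc m)) = (if j = m then complex_of_real (a m) else 0)"
    using assms \<kappa>_pos[of m] by (auto simp: \<kappa>_def)
  finally show ?thesis
  proof (rule Lim_transform_eventually)
    show "\<forall>\<^sub>F z in at_infinity. (P j z / z ^ j) * (1 / z) ^ (m - j) / (Etau z / z ^ Suc m) = z * (P j z / Etau z)"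
      using eventually_nonzero_at_infinity
    proof eventually_elim
      case (elim z)
      have "z ^ m = z ^ j * z ^ (m - j)" using assms by (simp flip: power_add)
      then show ?case using elim by (simp add: field_simps)
    qed
  qed
qed

lemma Etau_field_differentiable: "Etau field_differentiable at z"
proof -
  have "Etau = (\<lambda>z. P (Suc m) z - \<tau> * P m z)" by (auto simp: Etau_def)
  then show ?thesis by (auto intro!: derivative_intros corthp_field_differentiable simp del: corthp.simps)
qed

lemma continuous_carmona_density: "continuous_on UNIV carmona_density"
proof -
  have "norm (of_real (p (Suc m) x) - \<tau> * of_real (p m x)) \<noteq> 0" for x
    using Etau_nz[of "of_real x"] by (simp add: Etau_of_real)
  then have "pi * a m * (norm (of_real (p (Suc m) x) - \<tau> * of_real (p m x)))\<^sup>2 \<noteq> 0" for x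
    by simp
  then show ?thesis unfolding carmona_density_def by (intro continuous_intros) auto
qed

lemma carmona_density_pos: "carmona_density x > 0"
  using Etau_nz[of "of_real x"] \<tau> a_pos[of m] by (simp add: Etau_of_real carmona_density_def)

lemma p_asymp: "((\<lambda>x. p n x / x ^ n) \<longlongrightarrow> \<kappa> n) at_infinity"
proof -
  from filterlim_compose[OF P_asymp[of n] of_real_at_infinity]
  have "((\<lambda>x. of_real (p n x / x ^ n) :: complex) \<longlongrightarrow> of_real (\<kappa> n)) at_infinity"
    by (simp add: corthp_of_real)
  then show ?thesis by (simp only: tendsto_of_real_iff)
qed

text \<open>The numerator has degree at most 2m and the denominator |E|^2 has degree 2m + 2, so the
  integrand decays like 1 / x^2. This degree bound is the source of the restriction i + j < 2m in
  \<open>gram_matrix_eq\<close>.\<close>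

lemma carmona_integrable:
  assumes "i + j \<le> 2 * m"
  shows "integrable lborel (\<lambda>x. carmona_density x * (p i x * p j x))"
proof (rule integrable_of_tendsto_at_infinity)
  show "continuous_on UNIV (\<lambda>x. carmona_density x * (p i x * p j x))"
    by (intro continuous_intros continuous_carmona_density)
  have e: "((\<lambda>x. norm (Etau (of_real x) / of_real x ^ Suc m)) \<longlongrightarrow> norm (complex_of_real (\<kappa> (Suc m)))) at_infinity"
    by (intro tendsto_norm filterlim_compose[OF Etau_asymp of_real_at_infinity])
  define L where "L = Im \<tau> / (pi * a m * (norm (complex_of_real (\<kappa> (Suc m))))\<^sup>2) * (\<kappa> i * \<kappa> j * 0 ^ (2 * m - i - j) * (0\<^sup>2 + 1))"
  have "((\<lambda>x. Im \<tau> / (pi * a m * (norm (Etau (of_real x) / of_real x ^ Suc m))\<^sup>2)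
      * ((p i x / x ^ i) * (p j x / x ^ j) * (1 / x) ^ (2 * m - i - j) * ((1/x)\<^sup>2 + 1))) \<longlongrightarrow> L) at_infinity"
    unfolding L_def using \<kappa>_pos[of "Suc m"]
    by (intro tendsto_intros e p_asymp one_over_at_infinity) auto
  then show "((\<lambda>x. carmona_density x * (p i x * p j x) * (1 + x\<^sup>2)) \<longlongrightarrow> L) at_infinity"
  proof (rule Lim_transform_eventually)
    show "\<forall>\<^sub>F x in at_infinity. Im \<tau> / (pi * a m * (norm (Etau (of_real x) / of_real x ^ Suc m))\<^sup>2)
      * ((p i x / x ^ i) * (p j x / x ^ j) * (1 / x) ^ (2 * m - i - j) * ((1/x)\<^sup>2 + 1)) =
      carmona_density x * (p i x * p j x) * (1 + x\<^sup>2)"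
      using eventually_nonzero_at_infinity
    proof eventually_elim
      case (elim x)
      define E where "E = norm (Etau (of_real x))"
      have E: "E \<noteq> 0" using Etau_nz[of "of_real x"] by (simp add: E_def)
      have "x ^ i * x ^ j * x ^ (2 * m - i - j) = (x ^ m)\<^sup>2"
        using assms by (simp flip: power_add power_mult add: mult.commute)
      then have 1: "(p i x / x ^ i) * (p j x / x ^ j) * (1 / x) ^ (2 * m - i - j) = p i x * p j x / (x ^ m)\<^sup>2"
        unfolding power_one_over times_divide_times_eq mult_1_right by simp
      have 2: "(norm (Etau (of_real x) / of_real x ^ Suc m))\<^sup>2 = E\<^sup>2 / (x\<^sup>2 * (x ^ m)\<^sup>2)"
        by (simp add: norm_divide norm_mult norm_power E_def power_divide power_mult_distrib flip: power_abs)
      have 3: "(1 / x)\<^sup>2 + 1 = (1 + x\<^sup>2) / x\<^sup>2"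
        using elim by (simp add: field_simps)
      have 4: "carmona_density x = Im \<tau> / (pi * a m * E\<^sup>2)"
        by (simp add: carmona_density_def E_def Etau_of_real)
      have 5: "t / (c * (e / (S * T))) * (q / T * (u / S)) = t / (c * e) * q * u" if "S \<noteq> 0" "T \<noteq> 0" for t c e S T q u :: real
      proof -
        have "t / (c * (e / (S * T))) = t / (c * e) * (S * T)" by simp
        moreover have "(S * T) * (q / T * (u / S)) = q * u" using that by simp
        ultimately show ?thesis by (metis mult.assoc)
      qed
      show ?case unfolding 1 2 3 4 by (rule 5) (use elim in auto)
    qed
  qed
qed

text \<open>As \<open>Etau\<close> has no zeros in the closed lower half plane, \<open>c P_j / Etau\<close> integrates to its half residue at
  infinity; \<open>c = 1\<close> and \<open>c = \<tau>\<close> give the integrals of \<open>p_j\<close> against \<open>p_m\<close> and \<open>p_{m+1}\<close>.\<close>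

lemma carmona_contour:
  assumes "j \<le> m"
    and int: "integrable lborel (\<lambda>x. Im (c * (P j (of_real x) / Etau (of_real x))))"
  shows "(\<integral>x. Im (c * (P j (of_real x) / Etau (of_real x))) \<partial>lborel) = 
    pi * Re (c * (if j = m then of_real (a m) else 0))"
proof -
  let ?h = "\<lambda>z. c * (P j z / Etau z)"
  let ?L = "c * (if j = m then of_real (a m) else 0)"
  have lim: "((\<lambda>z. z * ?h z) \<longlongrightarrow> ?L) at_infinity"
    using tendsto_mult_left[OF P_div_Etau_asymp[OF assms(1)], of c] by (simp add: mult_ac)
  have diff: "?h field_differentiable at z" if "Im z \<le> 0" for z
    by (intro derivative_intros corthp_field_differentiable Etau_field_differentiable Etau_nz that)
  have "((\<lambda>R. integral {-R..R} (\<lambda>x. ?h (of_real x))) \<longlongrightarrow> \<i> * pi * ?L) at_top"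
    by (rule lower_half_plane_integral_tendsto[OF diff lim])
  then have "((\<lambda>R. Im (integral {-R..R} (\<lambda>x. ?h (of_real x)))) \<longlongrightarrow> Im (\<i> * pi * ?L)) at_top"
    by (rule tendsto_Im)
  moreover have "Im (integral {-R..R} (\<lambda>x. ?h (of_real x))) = integral {-R..R} (\<lambda>x. Im (?h (of_real x)))" for R
  proof -
    have "continuous_on {-R..R} (\<lambda>x. ?h (of_real x))"
    proof (rule continuous_on_compose2[of "{z. Im z \<le> 0}" ?h])
      show "continuous_on {z. Im z \<le> 0} ?h"
        using diff by (auto intro!: continuous_at_imp_continuous_on field_differentiable_imp_continuous_at)
    qed (auto intro!: continuous_intros)
    then have "(\<lambda>x. ?h (of_real x)) integrable_on {-R..R}"
      by (rule integrable_continuous_real)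
    from integral_linear[OF this bounded_linear_Im] show ?thesis
      by (simp add: o_def)
  qed
  ultimately have "((\<lambda>R. integral {-R..R} (\<lambda>x. Im (?h (of_real x)))) \<longlongrightarrow> pi * Re ?L) at_top"
    by simp
  from tendsto_unique[OF _ integral_symmetric_tendsto[OF int] this] show ?thesis by simp
qed

text \<open>Extend the fraction by the conjugate of E = p_{m+1} - \<tau> p_m. Without the factor
  \<tau> only the p_m term has an imaginary part; with it, that term becomes |\<tau>|^2 p_m, which
  is real, and only p_{m+1} contributes.\<close>

lemma Im_div_Etau:
  "Im (of_real u / Etau (of_real x)) = pi * a m * (carmona_density x * (p m x * u))"
  "Im (\<tau> * (of_real u / Etau (of_real x))) = pi * a m * (carmona_density x * (p (Suc m) x * u))"
proof -
  let ?v = "p (Suc m) x" and ?w = "p m x"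
  let ?E = "of_real ?v - \<tau> * of_real ?w :: complex"
  define D where "D = (norm ?E)\<^sup>2"
  have D: "D \<noteq> 0" using Etau_nz[of "of_real x"] by (simp add: D_def Etau_of_real del: orthp.simps)
  have dens: "carmona_density x = Im \<tau> / (pi * a m * D)"
    by (simp add: carmona_density_def D_def del: orthp.simps)
  have "Im (of_real u / Etau (of_real x)) = Im (of_real u * cnj ?E) / D"
    unfolding Etau_of_real D_def by (subst complex_div_cnj) (simp only: Im_divide_of_real flip: of_real_power)
  also have "Im (of_real u * cnj ?E) = Im \<tau> * (?w * u)" by (simp del: orthp.simps)
  finally show "Im (of_real u / Etau (of_real x)) = pi * a m * (carmona_density x * (p m x * u))"
    unfolding dens using D by (simp del: orthp.simps)
  have "Im (\<tau> * (of_real u / Etau (of_real x))) = Im (\<tau> * of_real u / ?E)"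
    unfolding Etau_of_real by simp
  also have "\<dots> = Im (\<tau> * of_real u * cnj ?E) / D"
    unfolding D_def by (subst complex_div_cnj) (simp only: Im_divide_of_real flip: of_real_power)
  also have "Im (\<tau> * of_real u * cnj ?E) = Im \<tau> * (?v * u)"
    by (simp add: algebra_simps del: orthp.simps)
  finally show "Im (\<tau> * (of_real u / Etau (of_real x))) = pi * a m * (carmona_density x * (p (Suc m) x * u))"
    unfolding dens using D by (simp del: orthp.simps)
qed

lemma carmona_orthonormal:
  assumes "i \<le> m" "j \<le> m"
  shows "(\<integral>x. carmona_density x * (p i x * p j x) \<partial>lborel) = of_bool (i = j)"
proof -
  define G where "G i j = (\<integral>x. carmona_density x * (p i x * p j x) \<partial>lborel)" for i j
  have top1: "G m j = of_bool (j = m)" if "j \<le> m" for j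
  proof -
    have int: "integrable lborel (\<lambda>x. carmona_density x * (p m x * p j x))"
      using that by (intro carmona_integrable) auto
    have "(\<integral>x. Im (1 * (P j (of_real x) / Etau (of_real x))) \<partial>lborel) = pi * a m * G m j"
      unfolding corthp_of_real mult_1 Im_div_Etau G_def by simp
    also have "(\<integral>x. Im (1 * (P j (of_real x) / Etau (of_real x))) \<partial>lborel) = pi * Re (1 * (if j = m then of_real (a m) else 0))"
    proof (rule carmona_contour[OF that])
      show "integrable lborel (\<lambda>x. Im (1 * (P j (of_real x) / Etau (of_real x))))"
        unfolding corthp_of_real mult_1 Im_div_Etau using int by simp
    qed
    finally show ?thesis by (auto split: if_splits)
  qed
  \<comment> \<open>The case j = m is excluded: the integrand would decay only like 1 / x.\<close>
  have top2: "G (Suc m) j = 0" if "j < m" for j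
  proof -
    have int: "integrable lborel (\<lambda>x. carmona_density x * (p (Suc m) x * p j x))"
      using that by (intro carmona_integrable) auto
    have "(\<integral>x. Im (\<tau> * (P j (of_real x) / Etau (of_real x))) \<partial>lborel) = pi * a m * G (Suc m) j"
      unfolding corthp_of_real Im_div_Etau G_def by simp
    also have "(\<integral>x. Im (\<tau> * (P j (of_real x) / Etau (of_real x))) \<partial>lborel) = pi * Re (\<tau> * (if j = m then of_real (a m) else 0))"
    proof (rule carmona_contour)
      show "integrable lborel (\<lambda>x. Im (\<tau> * (P j (of_real x) / Etau (of_real x))))"
        unfolding corthp_of_real Im_div_Etau using int by simp
    qed (use that in auto)
    finally show ?thesis using that by simp
  qed
  have "G i j = of_bool (i = j)"
  proof (rule gram_matrix_eq[where m = m])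
    show "G i j = G j i" for i j by (simp add: G_def mult.commute)
    fix i j assume ij: "i + j < 2 * m"
    have I: "integrable lborel (\<lambda>x. carmona_density x * (p i' x * p j' x))" if "i' + j' \<le> 2 * m" for i' j'
      using that by (rule carmona_integrable)
    have L: "(\<integral>x. carmona_density x * ((x * p k x) * p l x) \<partial>lborel) =
        (if k = 0 then 0 else a (k-1) * G (k-1) l) + b k * G k l + a k * G (Suc k) l" if "k + l < 2 * m" for k l
    proof (cases k)
      case 0
      have "(\<integral>x. carmona_density x * ((x * p k x) * p l x) \<partial>lborel) =
         (\<integral>x. b k * (carmona_density x * (p k x * p l x)) + a k * (carmona_density x * (p (Suc k) x * p l x)) \<partial>lborel)"
        using 0 by (subst p_rec) (simp add: algebra_simps del: orthp.simps)
      then show ?thesis using that 0 unfolding G_def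
        by (subst (asm) Bochner_Integration.integral_add) (auto intro!: integrable_mult_right I simp del: orthp.simps)
    next
      case (Suc k')
      have "(\<integral>x. carmona_density x * ((x * p k x) * p l x) \<partial>lborel) =
         (\<integral>x. a k' * (carmona_density x * (p k' x * p l x)) + (b k * (carmona_density x * (p k x * p l x)) + a k * (carmona_density x * (p (Suc k) x * p l x))) \<partial>lborel)"
        using Suc by (subst p_rec) (simp add: algebra_simps del: orthp.simps)
      then show ?thesis using that Suc unfolding G_def
        by (subst (asm) Bochner_Integration.integral_add, simp_all del: orthp.simps add: I)
    qed
    have "(\<integral>x. carmona_density x * ((x * p i x) * p j x) \<partial>lborel) = (\<integral>x. carmona_density x * ((x * p j x) * p i x) \<partial>lborel)"
      by (simp add: mult_ac)
    moreover have "G k l = G l k" for k l by (simp add: G_def mult.commute)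
    ultimately show "(if i = 0 then 0 else a (i-1) * G (i-1) j) + b i * G i j + a i * G (Suc i) j =
      (if j = 0 then 0 else a (j-1) * G i (j-1)) + b j * G i j + a j * G i (Suc j)"
      using L[of i j] L[of j i] ij by (simp add: add.commute)
  qed (use assms top1 top2 in auto)
  then show ?thesis by (simp add: G_def)
qed

end

end

subsection \<open>Uniqueness of the orthogonality measure\<close>

lemma norm_of_real_diff_ge_Im: "norm (of_real x - z) \<ge> \<bar>Im z\<bar>"
  using abs_Im_le_cmod[of "of_real x - z"] by simp

section \<open>Functions of the second kind and their Wronskian\<close>

context jacobi
begin

context
  fixes \<mu> :: "real measure"
  assumes orth: "is_orth_measure a b \<mu>"
begin

lemma orth_prob_space: "prob_space \<mu>" and orth_sets [measurable_cong]: "sets \<mu> = sets borel"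
  and orth_integrable: "integrable \<mu> (\<lambda>x. p n x * p m x)"
  and orth_integral: "(\<integral>x. p n x * p m x \<partial>\<mu>) = of_bool (n = m)"
  using orth unfolding is_orth_measure_def by auto

lemma orth_integrable1: "integrable \<mu> (p n)"
  using orth_integrable[of n 0] by simp

lemma orth_integral1: "(\<integral>x. p n x \<partial>\<mu>) = of_bool (n = 0)"
  using orth_integral[of n 0] by simp

lemma bessel:
  fixes f :: "real \<Rightarrow> real"
  assumes [measurable]: "f \<in> borel_measurable borel" and bdd: "\<And>x. \<bar>f x\<bar> \<le> C"
  shows "(\<Sum>n<M. (\<integral>x. p n x * f x \<partial>\<mu>)\<^sup>2) \<le> (\<integral>x. (f x)\<^sup>2 \<partial>\<mu>)"
proof -
  interpret prob_space \<mu> by (rule orth_prob_space)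
  define e where "e n = (\<integral>x. p n x * f x \<partial>\<mu>)" for n
  have ipf: "integrable \<mu> (\<lambda>x. p n x * f x)" for n
  proof (rule Bochner_Integration.integrable_bound)
    show "integrable \<mu> (\<lambda>x. C * p n x)" by (intro integrable_mult_right orth_integrable1)
    show "AE x in \<mu>. norm (p n x * f x) \<le> norm (C * p n x)"
    proof (rule AE_I2)
      fix x
      have "C \<ge> 0" using bdd[of 0] by linarith
      then show "norm (p n x * f x) \<le> norm (C * p n x)"
        using mult_left_mono[OF bdd[of x], of "\<bar>p n x\<bar>"] by (simp add: abs_mult mult.commute)
    qed
  qed measurable
  have iff: "integrable \<mu> (\<lambda>x. (f x)\<^sup>2)"
  proof (rule integrable_const_bound[where B = "C\<^sup>2"])
    show "AE x in \<mu>. norm ((f x)\<^sup>2) \<le> C\<^sup>2"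
      using bdd by (auto intro!: AE_I2 abs_le_square_iff[THEN iffD1] order_trans[OF bdd])
  qed measurable
  have "0 \<le> (\<integral>x. (f x - (\<Sum>n<M. e n * p n x))\<^sup>2 \<partial>\<mu>)" by simp
  also have "(\<lambda>x. (f x - (\<Sum>n<M. e n * p n x))\<^sup>2) = 
     (\<lambda>x. (f x)\<^sup>2 + ((\<Sum>n<M. \<Sum>k<M. (e n * e k) * (p n x * p k x)) - (\<Sum>n<M. (2 * e n) * (p n x * f x))))"
  proof
    fix x
    have "(\<Sum>n<M. e n * p n x)\<^sup>2 = (\<Sum>n<M. \<Sum>k<M. (e n * e k) * (p n x * p k x))"
      by (simp add: power2_eq_square sum_product mult_ac)
    moreover have "2 * f x * (\<Sum>n<M. e n * p n x) = (\<Sum>n<M. (2 * e n) * (p n x * f x))"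
      by (simp add: sum_distrib_left mult_ac)
    ultimately show "(f x - (\<Sum>n<M. e n * p n x))\<^sup>2 = (f x)\<^sup>2 + ((\<Sum>n<M. \<Sum>k<M. (e n * e k) * (p n x * p k x)) - (\<Sum>n<M. (2 * e n) * (p n x * f x)))"
      by (simp add: power2_diff)
  qed
  also have "(\<integral>x. (f x)\<^sup>2 + ((\<Sum>n<M. \<Sum>k<M. (e n * e k) * (p n x * p k x)) - (\<Sum>n<M. (2 * e n) * (p n x * f x))) \<partial>\<mu>) =
     (\<integral>x. (f x)\<^sup>2 \<partial>\<mu>) + ((\<Sum>n<M. \<Sum>k<M. (e n * e k) * of_bool (n = k)) - (\<Sum>n<M. (2 * e n) * e n))"
    by (simp add: iff ipf orth_integrable orth_integral Bochner_Integration.integral_sum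
        Bochner_Integration.integral_diff Bochner_Integration.integral_add e_def[symmetric])
  also have "\<dots> = (\<integral>x. (f x)\<^sup>2 \<partial>\<mu>) - (\<Sum>n<M. (e n)\<^sup>2)"
    by (simp add: of_bool_def if_distrib sum.delta power2_eq_square sum_distrib_left mult.assoc sum_negf flip: sum_subtractf cong: if_cong)
  finally show ?thesis by (simp add: e_def)
qed

text \<open>These are the functions of the second kind and, at the same time, the Fourier
  coefficients of 1 / (x - z) with respect to the orthonormal system.\<close>

definition cauchy_coeff :: "complex \<Rightarrow> nat \<Rightarrow> complex" where
  "cauchy_coeff z n = (\<integral>x. of_real (p n x) / (of_real x - z) \<partial>\<mu>)"

context
  fixes z :: complex
  assumes z: "Im z \<noteq> 0"
begin

lemma inverse_diff_bound: "norm (1 / (of_real x - z)) \<le> 1 / \<bar>Im z\<bar>"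
  using norm_of_real_diff_ge_Im[of z x] z by (simp add: norm_divide frac_le)

lemma cauchy_integrable: "integrable \<mu> (\<lambda>x. of_real (p n x) / (of_real x - z))"
proof (rule Bochner_Integration.integrable_bound)
  show "integrable \<mu> (\<lambda>x. p n x * (1 / \<bar>Im z\<bar>))" by (intro integrable_mult_left orth_integrable1)
  show "AE x in \<mu>. norm (of_real (p n x) / (of_real x - z)) \<le> norm (p n x * (1 / \<bar>Im z\<bar>))"
  proof (rule AE_I2)
    fix x
    show "norm (of_real (p n x) / (of_real x - z)) \<le> norm (p n x * (1 / \<bar>Im z\<bar>))"
      using mult_left_mono[OF inverse_diff_bound[of x], of "\<bar>p n x\<bar>"]
      by (simp add: norm_divide abs_mult)
  qed
qed measurable

text \<open>Integrate the three-term recurrence against 1 / (x - z) and use x / (x - z) = 1 + z / (x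
  - z). The summand 1 leaves the integral of \<open>p n\<close>, which is nonzero only for n =
  0.\<close>

lemma cauchy_coeff_rec:
  "(if n = 0 then 0 else of_real (a (n-1)) * cauchy_coeff z (n-1)) + of_real (b n) * cauchy_coeff z n
     + of_real (a n) * cauchy_coeff z (Suc n) = of_bool (n = 0) + z * cauchy_coeff z n"
proof -
  interpret prob_space \<mu> by (rule orth_prob_space)
  let ?f = "\<lambda>n x. of_real (p n x) / (of_real x - z) :: complex"
  have eq: "complex_of_real (p n x) + z * ?f n x = of_real (x * p n x) / (of_real x - z)" for x
  proof -
    have "of_real x - z \<noteq> 0" using z by (auto simp: complex_eq_iff)
    then show ?thesis by (simp add: field_simps)
  qed
  have "of_bool (n = 0) + z * cauchy_coeff z n = (\<integral>x. complex_of_real (p n x) + z * ?f n x \<partial>\<mu>)"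
  proof (subst Bochner_Integration.integral_add)
    show "integrable \<mu> (\<lambda>x. complex_of_real (p n x))"
      using orth_integrable1 by simp
    show "integrable \<mu> (\<lambda>x. z * ?f n x)"
      by (intro integrable_mult_right cauchy_integrable)
    show "of_bool (n = 0) + z * cauchy_coeff z n = (\<integral>x. complex_of_real (p n x) \<partial>\<mu>) + (\<integral>x. z * ?f n x \<partial>\<mu>)"
      unfolding cauchy_coeff_def integral_complex_of_real orth_integral1 integral_mult_right_zero by simp
  qed
  also have "\<dots> = (\<integral>x. of_real (x * p n x) / (of_real x - z) \<partial>\<mu>)"
    unfolding eq ..
  also have "\<dots> = (\<integral>x. (if n = 0 then 0 else of_real (a (n-1)) * ?f (n-1) x) + (of_real (b n) * ?f n x + of_real (a n) * ?f (Suc n) x) \<partial>\<mu>)"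
    unfolding p_rec by (intro Bochner_Integration.integral_cong refl, cases n) (simp_all add: add_divide_distrib del: orthp.simps)
  also have "\<dots> = (if n = 0 then 0 else of_real (a (n-1)) * cauchy_coeff z (n-1)) + (of_real (b n) * cauchy_coeff z n
     + of_real (a n) * cauchy_coeff z (Suc n))"
    unfolding cauchy_coeff_def
    by (simp add: cauchy_integrable Bochner_Integration.integral_add
        del: orthp.simps times_divide_eq_right times_divide_eq_left)
  finally show ?thesis by (simp add: add.assoc)
qed

text \<open>\<open>bessel\<close> is stated for real bounded functions; the real and imaginary parts
  of 1 / (x - z) are both bounded by 1 / |Im z|.\<close>

lemma cauchy_coeff_square_summable: "summable (\<lambda>n. (norm (cauchy_coeff z n))\<^sup>2)"
proof (rule summableI_nonneg_bounded)
  let ?r = "\<lambda>x. Re (1 / (of_real x - z))" and ?i = "\<lambda>x. Im (1 / (of_real x - z))"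
  fix M
  have re: "\<bar>?r x\<bar> \<le> 1 / \<bar>Im z\<bar>" and im: "\<bar>?i x\<bar> \<le> 1 / \<bar>Im z\<bar>" for x
    using order_trans[OF abs_Re_le_cmod inverse_diff_bound[of x]] order_trans[OF abs_Im_le_cmod inverse_diff_bound[of x]] by auto
  have Re: "Re (cauchy_coeff z n) = (\<integral>x. p n x * ?r x \<partial>\<mu>)" for n
    unfolding cauchy_coeff_def by (subst integral_Re[OF cauchy_integrable, symmetric]) (simp add: Re_divide)
  have Im: "Im (cauchy_coeff z n) = (\<integral>x. p n x * ?i x \<partial>\<mu>)" for n
    unfolding cauchy_coeff_def by (subst integral_Im[OF cauchy_integrable, symmetric]) (simp add: Im_divide)
  have "(\<Sum>n<M. (norm (cauchy_coeff z n))\<^sup>2) = (\<Sum>n<M. (\<integral>x. p n x * ?r x \<partial>\<mu>)\<^sup>2) + (\<Sum>n<M. (\<integral>x. p n x * ?i x \<partial>\<mu>)\<^sup>2)"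
    by (simp add: cmod_power2 Re Im sum.distrib)
  also have "\<dots> \<le> (\<integral>x. (?r x)\<^sup>2 \<partial>\<mu>) + (\<integral>x. (?i x)\<^sup>2 \<partial>\<mu>)"
    by (intro add_mono bessel[OF _ re] bessel[OF _ im]) measurable
  finally show "(\<Sum>n<M. (norm (cauchy_coeff z n))\<^sup>2) \<le> (\<integral>x. (?r x)\<^sup>2 \<partial>\<mu>) + (\<integral>x. (?i x)\<^sup>2 \<partial>\<mu>)" .
qed simp

end
end

lemma cauchy_transform_unique:
  assumes \<mu>: "is_orth_measure a b \<mu>" and \<nu>: "is_orth_measure a b \<nu>"
    and div: "\<not> summable (\<lambda>n. 1 / a n)" and z: "Im z \<noteq> 0"
  shows "(\<integral>x. 1 / (of_real x - z) \<partial>\<mu>) = (\<integral>x. 1 / (of_real x - z) \<partial>\<nu>)"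
proof -
  define c where "c n = cauchy_coeff \<mu> z n" for n
  define d where "d n = c n - cauchy_coeff \<nu> z n" for n
  have c_rec: "(if n = 0 then 0 else of_real (a (n-1)) * c (n-1)) + of_real (b n) * c n
     + of_real (a n) * c (Suc n) = of_bool (n = 0) + z * c n" for n
    unfolding c_def by (rule cauchy_coeff_rec[OF \<mu> z])
  have d_rec: "(if n = 0 then 0 else of_real (a (n-1)) * d (n-1)) + of_real (b n) * d n
     + of_real (a n) * d (Suc n) = z * d n" for n
    using c_rec[of n] cauchy_coeff_rec[OF \<nu> z, of n] unfolding d_def
    by (cases n) (simp_all add: algebra_simps)
  \<comment> \<open>The inhomogeneity 1 in the recurrence of \<open>c\<close> at index 0 starts the
    Wronskian at \<open>d 0\<close>; from index 1 on both sequences satisfy the same homogeneous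
    recurrence.\<close>
  have W: "of_real (a n) * (d n * c (Suc n) - d (Suc n) * c n) = d 0" for n
  proof (induction n)
    case 0
    have "of_real (a 0) * c (Suc 0) = 1 + (z - of_real (b 0)) * c 0"
      and "of_real (a 0) * d (Suc 0) = (z - of_real (b 0)) * d 0"
      using c_rec[of 0] d_rec[of 0] by (simp_all add: algebra_simps)
    note e = this
    have "d 0 * (of_real (a 0) * c (Suc 0)) - (of_real (a 0) * d (Suc 0)) * c 0 = d 0"
      unfolding e by (simp add: algebra_simps)
    then show ?case by (simp add: algebra_simps)
  next
    case (Suc n)
    have "of_real (a (Suc n)) * c (Suc (Suc n)) = (z - of_real (b (Suc n))) * c (Suc n) - of_real (a n) * c n"
      and "of_real (a (Suc n)) * d (Suc (Suc n)) = (z - of_real (b (Suc n))) * d (Suc n) - of_real (a n) * d n"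
      using c_rec[of "Suc n"] d_rec[of "Suc n"] by (simp_all add: algebra_simps)
    note e = this
    have "d (Suc n) * (of_real (a (Suc n)) * c (Suc (Suc n))) - (of_real (a (Suc n)) * d (Suc (Suc n))) * c (Suc n)
       = of_real (a n) * (d n * c (Suc n) - d (Suc n) * c n)"
      unfolding e by (simp add: algebra_simps)
    then show ?case using Suc by (simp add: algebra_simps)
  qed
  have sc: "summable (\<lambda>n. (norm (c n))\<^sup>2)"
    unfolding c_def by (rule cauchy_coeff_square_summable[OF \<mu> z])
  have sd: "summable (\<lambda>n. (norm (d n))\<^sup>2)"
  proof (rule summable_comparison_test)
    show "summable (\<lambda>n. 2 * (norm (c n))\<^sup>2 + 2 * (norm (cauchy_coeff \<nu> z n))\<^sup>2)"
      by (intro summable_add summable_mult sc cauchy_coeff_square_summable[OF \<nu> z])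
    have "(norm (d n))\<^sup>2 \<le> 2 * (norm (c n))\<^sup>2 + 2 * (norm (cauchy_coeff \<nu> z n))\<^sup>2" for n
    proof -
      have "(norm (d n))\<^sup>2 \<le> (norm (c n) + norm (cauchy_coeff \<nu> z n))\<^sup>2"
        unfolding d_def by (intro power_mono norm_triangle_ineq4) auto
      also have "\<dots> \<le> 2 * (norm (c n))\<^sup>2 + 2 * (norm (cauchy_coeff \<nu> z n))\<^sup>2"
        using sum_squares_bound[of "norm (c n)" "norm (cauchy_coeff \<nu> z n)"] by (simp add: power2_sum)
      finally show ?thesis .
    qed
    then show "\<exists>N. \<forall>n\<ge>N. norm ((norm (d n))\<^sup>2) \<le> 2 * (norm (c n))\<^sup>2 + 2 * (norm (cauchy_coeff \<nu> z n))\<^sup>2"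
      by auto
  qed
  have "d 0 = 0"
  proof (rule ccontr)
    assume d0: "d 0 \<noteq> 0"
    have "summable (\<lambda>n. norm (d 0) * (1 / a n))"
    proof (rule summable_comparison_test)
      show "summable (\<lambda>n. ((norm (d n))\<^sup>2 + (norm (c (Suc n)))\<^sup>2) + ((norm (d (Suc n)))\<^sup>2 + (norm (c n))\<^sup>2))"
        using sc sd summable_Suc_iff[of "\<lambda>n. (norm (c n))\<^sup>2"] summable_Suc_iff[of "\<lambda>n. (norm (d n))\<^sup>2"]
        by (intro summable_add) auto
      have "norm (d 0) * (1 / a n) \<le> ((norm (d n))\<^sup>2 + (norm (c (Suc n)))\<^sup>2) + ((norm (d (Suc n)))\<^sup>2 + (norm (c n))\<^sup>2)" for n
      proof -
        have "norm (d 0) = a n * norm (d n * c (Suc n) - d (Suc n) * c n)"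
          using W[of n, symmetric] a_pos[of n] by (simp add: norm_mult)
        then have "norm (d 0) * (1 / a n) = norm (d n * c (Suc n) - d (Suc n) * c n)"
          by simp
        also have "\<dots> \<le> norm (d n) * norm (c (Suc n)) + norm (d (Suc n)) * norm (c n)"
          by (metis norm_mult norm_triangle_ineq4)
        also have "\<dots> \<le> ((norm (d n))\<^sup>2 + (norm (c (Suc n)))\<^sup>2) + ((norm (d (Suc n)))\<^sup>2 + (norm (c n))\<^sup>2)"
          using sum_squares_bound[of "norm (d n)" "norm (c (Suc n))"] sum_squares_bound[of "norm (d (Suc n))" "norm (c n)"]
            mult_nonneg_nonneg[OF norm_ge_zero norm_ge_zero, of "d n" "c (Suc n)"]
            mult_nonneg_nonneg[OF norm_ge_zero norm_ge_zero, of "d (Suc n)" "c n"]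
          unfolding mult.assoc by linarith
        finally show ?thesis .
      qed
      then show "\<exists>N. \<forall>n\<ge>N. norm (norm (d 0) * (1 / a n)) \<le> ((norm (d n))\<^sup>2 + (norm (c (Suc n)))\<^sup>2) + ((norm (d (Suc n)))\<^sup>2 + (norm (c n))\<^sup>2)"
        using a_pos by (auto simp: abs_mult less_imp_le)
    qed
    then have "summable (\<lambda>n. 1 / a n)" using d0 by (subst (asm) summable_cmult_iff) auto
    then show False using div by simp
  qed
  then show ?thesis by (simp add: d_def c_def cauchy_coeff_def[OF \<mu>] cauchy_coeff_def[OF \<nu>])
qed

end

section \<open>Stieltjes inversion\<close>

lemma nn_integral_arctan_kernel:
  fixes M :: "real measure"
  assumes "prob_space M" and sets: "sets M = sets borel" and y: "y > 0" and "\<alpha> \<le> \<beta>"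
  shows "(\<integral>\<^sup>+x. ennreal (arctan ((\<beta> - x) / y) - arctan ((\<alpha> - x) / y)) \<partial>M) =
    (\<integral>\<^sup>+t. ennreal (Im (\<integral>x. 1 / (of_real x - Complex t y) \<partial>M)) * indicator {\<alpha>..\<beta>} t \<partial>lborel)"
proof -
  interpret prob_space M by fact
  interpret pair_sigma_finite M lborel ..
  note sets[measurable_cong]
  \<comment> \<open>This is the Poisson kernel, the imaginary part of 1 / (x - t - i y). Its
    t-primitive is arctan ((t - x) / y), and as it is nonnegative the two integrations may be
    exchanged by Tonelli.\<close>
  let ?k = "\<lambda>t x. y / ((x - t)\<^sup>2 + y\<^sup>2)"
  have pos: "(x - t)\<^sup>2 + y\<^sup>2 > 0" for x t using y by (simp add: add_nonneg_pos)
  have inner1: "(\<integral>\<^sup>+t. ennreal (?k t x) * indicator {\<alpha>..\<beta>} t \<partial>lborel) =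
      ennreal (arctan ((\<beta> - x) / y) - arctan ((\<alpha> - x) / y))" for x
  proof (rule nn_integral_FTC_Icc[where F = "\<lambda>t. arctan ((t - x) / y)"])
    fix t
    have "((\<lambda>t. arctan ((t - x) / y)) has_real_derivative (1 / y) / (1 + ((t - x) / y)\<^sup>2)) (at t)"
      by (auto intro!: derivative_eq_intros simp: divide_inverse)
    moreover have "(1 / y) / (1 + ((t - x) / y)\<^sup>2) = ?k t x"
      using y pos[of x t] by (simp add: divide_simps power_divide) (simp add: power2_eq_square algebra_simps)
    ultimately show "((\<lambda>t. arctan ((t - x) / y)) has_real_derivative ?k t x) (at t)" by simp
    show "0 \<le> ?k t x" using y pos[of x t] by simp
  qed (use assms in auto)
  have inner2: "(\<integral>\<^sup>+x. ennreal (?k t x) \<partial>M) = ennreal (Im (\<integral>x. 1 / (of_real x - Complex t y) \<partial>M))" for t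
  proof -
    have Im: "Im (1 / (of_real x - Complex t y)) = ?k t x" for x
      by (simp add: Im_divide)
    have int: "integrable M (\<lambda>x. 1 / (of_real x - Complex t y))"
    proof (rule integrable_const_bound[where B = "1 / y"])
      show "AE x in M. norm (1 / (of_real x - Complex t y)) \<le> 1 / y"
        using norm_of_real_diff_ge_Im[of "Complex t y"] y by (auto simp: norm_divide intro!: AE_I2 frac_le)
    qed measurable
    have "integrable M (\<lambda>x. ?k t x)"
      using integrable_Im[OF int] unfolding Im .
    then have "(\<integral>\<^sup>+x. ennreal (?k t x) \<partial>M) = ennreal (\<integral>x. ?k t x \<partial>M)"
      using y pos by (intro nn_integral_eq_integral) (auto simp: less_imp_le)
    also have "(\<integral>x. ?k t x \<partial>M) = Im (\<integral>x. 1 / (of_real x - Complex t y) \<partial>M)"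
      unfolding Im[symmetric] by (rule integral_Im[OF int])
    finally show ?thesis .
  qed
  have "(\<integral>\<^sup>+x. ennreal (arctan ((\<beta> - x) / y) - arctan ((\<alpha> - x) / y)) \<partial>M) =
    (\<integral>\<^sup>+x. \<integral>\<^sup>+t. ennreal (?k t x) * indicator {\<alpha>..\<beta>} t \<partial>lborel \<partial>M)"
    unfolding inner1 ..
  also have "\<dots> = (\<integral>\<^sup>+t. \<integral>\<^sup>+x. ennreal (?k t x) * indicator {\<alpha>..\<beta>} t \<partial>M \<partial>lborel)"
    by (rule Fubini'[symmetric]) measurable
  also have "\<dots> = (\<integral>\<^sup>+t. (\<integral>\<^sup>+x. ennreal (?k t x) \<partial>M) * indicator {\<alpha>..\<beta>} t \<partial>lborel)"
    by (intro nn_integral_cong nn_integral_multc) measurable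
  finally show ?thesis unfolding inner2 .
qed

lemma arctan_scaled_tendsto: "(\<lambda>k. arctan (c * real (Suc k))) \<longlonglongrightarrow> pi / 2 * sgn (c :: real)"
proof (cases c "0 :: real" rule: linorder_cases)
  case equal
  then show ?thesis by simp
next
  case greater
  have "filterlim (\<lambda>k. c * real (Suc k)) at_top sequentially"
    by (rule filterlim_tendsto_pos_mult_at_top[OF tendsto_const greater])
       (rule filterlim_compose[OF filterlim_real_sequentially filterlim_Suc])
  from filterlim_compose[OF tendsto_arctan_at_top this] greater show ?thesis by simp
next
  case less
  then have "- c > 0" by simp
  have "filterlim (\<lambda>k. (- c) * real (Suc k)) at_top sequentially"
    by (rule filterlim_tendsto_pos_mult_at_top[OF tendsto_const \<open>- c > 0\<close>])
       (rule filterlim_compose[OF filterlim_real_sequentially filterlim_Suc])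
  from tendsto_minus[OF filterlim_compose[OF tendsto_arctan_at_top this]] less show ?thesis
    by (simp add: arctan_minus)
qed

text \<open>As the height y = 1 / (k + 1) shrinks, the arctan kernel converges everywhere, boundedly
  by pi. At the endpoints the limit is 0 for the corresponding arctan, so an atom there counts with
  half weight; hence \<open>sgn\<close> instead of an indicator.\<close>

lemma integral_sgn_tendsto:
  fixes M :: "real measure"
  assumes "prob_space M" and sets: "sets M = sets borel"
  shows "(\<lambda>k. \<integral>x. arctan ((\<beta> - x) / (1 / real (Suc k))) - arctan ((\<alpha> - x) / (1 / real (Suc k))) \<partial>M)
     \<longlonglongrightarrow> (\<integral>x. pi / 2 * sgn (\<beta> - x) - pi / 2 * sgn (\<alpha> - x) \<partial>M)"
proof -
  interpret prob_space M by fact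
  note sets[measurable_cong]
  show ?thesis
  proof (rule integral_dominated_convergence[where w = "\<lambda>_. pi"])
    show "AE x in M. (\<lambda>k. arctan ((\<beta> - x) / (1 / real (Suc k))) - arctan ((\<alpha> - x) / (1 / real (Suc k))))
        \<longlonglongrightarrow> pi / 2 * sgn (\<beta> - x) - pi / 2 * sgn (\<alpha> - x)"
      using tendsto_diff[OF arctan_scaled_tendsto arctan_scaled_tendsto] by simp
    fix k
    show "AE x in M. norm (arctan ((\<beta> - x) / (1 / real (Suc k))) - arctan ((\<alpha> - x) / (1 / real (Suc k)))) \<le> pi"
    proof (rule AE_I2)
      fix x
      show "norm (arctan ((\<beta> - x) / (1 / real (Suc k))) - arctan ((\<alpha> - x) / (1 / real (Suc k)))) \<le> pi"
        using arctan_bounded[of "(\<beta> - x) / (1 / real (Suc k))"] arctan_bounded[of "(\<alpha> - x) / (1 / real (Suc k))"]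
        unfolding real_norm_def by linarith
    qed
  qed (auto intro!: borel_measurable_diff borel_measurable_times simp: sets)
qed

text \<open>Stieltjes inversion: letting the imaginary part tend to 0 recovers the average of the left and
  right limits of the distribution function, and hence the function itself by right continuity.\<close>

lemma cauchy_transform_determines:
  fixes M1 M2 :: "real measure"
  assumes M1: "prob_space M1" "sets M1 = sets borel" and M2: "prob_space M2" "sets M2 = sets borel"
    and eq: "\<And>z. Im z > 0 \<Longrightarrow> (\<integral>x. 1 / (of_real x - z) \<partial>M1) = (\<integral>x. 1 / (of_real x - z) \<partial>M2)"
  shows "M1 = M2"
proof -
  \<comment> \<open>With F the distribution function, \<open>h M t\<close> is F(t) + F(t-) -
    1.\<close>
  define h where "h M t = (\<integral>x. sgn (t - x) \<partial>M)" for M :: "real measure" and t :: real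
  have isgn: "integrable M (\<lambda>x. sgn (t - x))" if "prob_space M" "sets M = sets borel" for M :: "real measure" and t :: real
  proof -
    interpret prob_space M by fact
    note that(2)[measurable_cong]
    show ?thesis
      by (rule integrable_const_bound[where B = 1]) (auto simp: abs_sgn_eq that)
  qed
  have diff: "h M1 \<beta> - h M1 \<alpha> = h M2 \<beta> - h M2 \<alpha>" if "\<alpha> \<le> \<beta>" for \<alpha> \<beta>
  proof -
    have K: "(\<integral>x. arctan ((\<beta> - x) / y) - arctan ((\<alpha> - x) / y) \<partial>M1) = (\<integral>x. arctan ((\<beta> - x) / y) - arctan ((\<alpha> - x) / y) \<partial>M2)"
      if y: "y > 0" for y
    proof -
      have nn: "0 \<le> arctan ((\<beta> - x) / y) - arctan ((\<alpha> - x) / y)" for x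
        using \<open>\<alpha> \<le> \<beta>\<close> y by (simp add: arctan_le_iff divide_right_mono)
      have "(\<integral>\<^sup>+x. ennreal (arctan ((\<beta> - x) / y) - arctan ((\<alpha> - x) / y)) \<partial>M1) =
        (\<integral>\<^sup>+x. ennreal (arctan ((\<beta> - x) / y) - arctan ((\<alpha> - x) / y)) \<partial>M2)"
        unfolding nn_integral_arctan_kernel[OF M1 y \<open>\<alpha> \<le> \<beta>\<close>] nn_integral_arctan_kernel[OF M2 y \<open>\<alpha> \<le> \<beta>\<close>]
        using y by (subst eq) auto
      moreover have "(\<integral>x. arctan ((\<beta> - x) / y) - arctan ((\<alpha> - x) / y) \<partial>M) =
          enn2real (\<integral>\<^sup>+x. ennreal (arctan ((\<beta> - x) / y) - arctan ((\<alpha> - x) / y)) \<partial>M)"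
        if [measurable_cong]: "sets M = sets borel" for M :: "real measure"
        by (rule integral_eq_nn_integral[OF _ AE_I2[OF nn]]) measurable
      ultimately show ?thesis using M1 M2 by simp
    qed
    have "(\<integral>x. pi / 2 * sgn (\<beta> - x) - pi / 2 * sgn (\<alpha> - x) \<partial>M1) = (\<integral>x. pi / 2 * sgn (\<beta> - x) - pi / 2 * sgn (\<alpha> - x) \<partial>M2)"
    proof (rule LIMSEQ_unique[OF integral_sgn_tendsto[OF M1]])
      show "(\<lambda>k. \<integral>x. arctan ((\<beta> - x) / (1 / real (Suc k))) - arctan ((\<alpha> - x) / (1 / real (Suc k))) \<partial>M1)
        \<longlonglongrightarrow> (\<integral>x. pi / 2 * sgn (\<beta> - x) - pi / 2 * sgn (\<alpha> - x) \<partial>M2)"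
        by (subst K) (auto intro: integral_sgn_tendsto[OF M2, simplified])
    qed
    then have "pi / 2 * (h M1 \<beta> - h M1 \<alpha>) = pi / 2 * (h M2 \<beta> - h M2 \<alpha>)"
      using isgn[OF M1] isgn[OF M2] unfolding h_def by (simp add: right_diff_distrib)
    then show ?thesis by simp
  qed
  \<comment> \<open>Inversion yields only differences of \<open>h\<close>; the value at minus
    infinity fixes the additive constant.\<close>
  have lim: "(\<lambda>k. h M (- real k)) \<longlonglongrightarrow> -1" if M: "prob_space M" "sets M = sets borel" for M
  proof -
    interpret prob_space M by fact
    note that(2)[measurable_cong]
    have "(\<lambda>k. \<integral>x. sgn (- real k - x) \<partial>M) \<longlonglongrightarrow> (\<integral>x. -1 \<partial>M)"
    proof (rule integral_dominated_convergence[where w = "\<lambda>_. 1"])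
      show "AE x in M. (\<lambda>k. sgn (- real k - x)) \<longlonglongrightarrow> - 1"
      proof (rule AE_I2, rule tendsto_eventually)
        fix x
        obtain k0 :: nat where "real k0 > - x" using reals_Archimedean2 by blast
        then show "\<forall>\<^sub>F k in sequentially. sgn (- real k - x) = - 1"
          by (intro eventually_sequentiallyI[of k0]) (auto simp: sgn_if)
      qed
    qed (auto simp: that abs_sgn_eq)
    then show ?thesis by (simp add: h_def prob_space)
  qed
  have h_eq: "h M1 t = h M2 t" for t
  proof (rule LIMSEQ_unique)
    obtain k0 :: nat where k0: "real k0 > - t" using reals_Archimedean2 by blast
    have "(\<lambda>k. h M1 t - h M1 (- real k)) \<longlonglongrightarrow> h M1 t - (-1)"
      by (intro tendsto_intros lim M1)
    moreover have "\<forall>\<^sub>F k in sequentially. h M1 t - h M1 (- real k) = h M2 t - h M2 (- real k)"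
      using k0 by (intro eventually_sequentiallyI[of k0] diff) auto
    ultimately have "(\<lambda>k. h M2 t - h M2 (- real k)) \<longlonglongrightarrow> h M1 t - (-1)"
      by (rule Lim_transform_eventually)
    from tendsto_diff[OF this tendsto_const[of 1]]
    show "(\<lambda>k. h M2 t - h M2 (- real k) - 1) \<longlonglongrightarrow> h M1 t" by simp
    have "(\<lambda>k. h M2 t - h M2 (- real k) - 1) \<longlonglongrightarrow> h M2 t - (-1) - 1"
      by (intro tendsto_intros lim M2)
    then show "(\<lambda>k. h M2 t - h M2 (- real k) - 1) \<longlonglongrightarrow> h M2 t" by simp
  qed
  \<comment> \<open>Comparing \<open>sgn\<close> with indicators traps \<open>h\<close> between
    values of the distribution function at t and s > t, so left limits never have to be
    handled.\<close>
  have bounds: "2 * cdf M t - 1 \<le> h M s" "h M s \<le> 2 * cdf M s - 1"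
    if M: "prob_space M" "sets M = sets borel" and "t < s" for M t s
  proof -
    interpret prob_space M by fact
    have ii: "integrable M (\<lambda>x. 2 * indicator {..t} x - 1 :: real)" for t
      using M by (intro Bochner_Integration.integrable_diff integrable_mult_right integrable_real_indicator) (auto simp: emeasure_eq_measure)
    have I: "(\<integral>x. 2 * indicator {..t} x - 1 \<partial>M) = 2 * cdf M t - 1" for t
      using M by (subst Bochner_Integration.integral_diff) (auto simp: cdf_def prob_space emeasure_eq_measure intro!: integrable_mult_right integrable_real_indicator)
    show "2 * cdf M t - 1 \<le> h M s"
      unfolding h_def I[symmetric] using \<open>t < s\<close> 
      by (intro integral_mono ii isgn M) (auto simp: indicator_def sgn_if)
    show "h M s \<le> 2 * cdf M s - 1"
      unfolding h_def I[symmetric]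
      by (intro integral_mono ii isgn M) (auto simp: indicator_def sgn_if)
  qed
  have rd: "real_distribution M1" "real_distribution M2"
    using M1 M2 by (auto simp: real_distribution_def real_distribution_axioms_def)
  \<comment> \<open>For s > t the bounds give F(t) <= (h(s) + 1) / 2 <= F'(s) for the two
    distribution functions F and F'; then s decreases to t.\<close>
  have le: "cdf M t \<le> cdf M' t" if M: "real_distribution M" "real_distribution M'" and eq: "\<And>t. h M t = h M' t" for M M' t
  proof (rule tendsto_lowerbound)
    interpret M': real_distribution M' by fact
    show "(cdf M' \<longlongrightarrow> cdf M' t) (at_right t)"
      using M'.cdf_is_right_cont[of t] by (simp add: continuous_within)
    show "\<forall>\<^sub>F s in at_right t. cdf M t \<le> cdf M' s"
      unfolding eventually_at_right_field
    proof (intro exI[of _ "t + 1"] conjI allI impI)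
      fix s assume "t < s"
      then show "cdf M t \<le> cdf M' s"
        using bounds(1)[of M t s] bounds(2)[of M' t s] M eq[of s]
        by (simp add: real_distribution_def real_distribution_axioms_def)
    qed simp
  qed simp
  show ?thesis
    using rd by (intro cdf_unique ext antisym le h_eq h_eq[symmetric])
qed

theorem (in jacobi) orth_measure_unique:
  assumes "is_orth_measure a b \<mu>" "is_orth_measure a b \<nu>" "\<not> summable (\<lambda>n. 1 / a n)"
  shows "\<mu> = \<nu>"
  using assms
  by (intro cauchy_transform_determines cauchy_transform_unique orth_prob_space orth_sets) auto

subsection \<open>Passing to the limit in the measures\<close>

text \<open>Chebyshev's argument: outside [-R, R] the weight satisfies 1 + x^2 >= 1 + R^2, so
  |\<phi>| is at most \<psi> / (1 + R^2) there.\<close>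

lemma weighted_tail_bound:
  fixes \<phi> \<psi> v :: "real \<Rightarrow> real"
  assumes [measurable]: "\<phi> \<in> borel_measurable borel" "v \<in> borel_measurable borel"
    and v: "\<And>x. v x \<ge> 0" and \<phi>: "\<And>x. \<bar>\<phi> x\<bar> * (1 + x\<^sup>2) \<le> \<psi> x"
    and int: "integrable lborel (\<lambda>x. \<psi> x * v x)" and C: "(\<integral>x. \<psi> x * v x \<partial>lborel) \<le> C"
  shows "integrable lborel (\<lambda>x. \<phi> x * v x)"
    and "R \<ge> 0 \<Longrightarrow> \<bar>(\<integral>x. \<phi> x * v x \<partial>lborel) - (\<integral>x. indicator {-R..R} x * (\<phi> x * v x) \<partial>lborel)\<bar> \<le> C / (1 + R\<^sup>2)"
proof -
  have \<psi>: "\<bar>\<phi> x\<bar> \<le> \<psi> x" for x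
    using \<phi>[of x] mult_left_mono[of 1 "1 + x\<^sup>2" "\<bar>\<phi> x\<bar>"] by simp
  show i: "integrable lborel (\<lambda>x. \<phi> x * v x)"
  proof (rule Bochner_Integration.integrable_bound[OF int])
    show "AE x in lborel. norm (\<phi> x * v x) \<le> norm (\<psi> x * v x)"
    proof (rule AE_I2)
      fix x
      have "0 \<le> \<psi> x" using \<psi>[of x] by linarith
      then show "norm (\<phi> x * v x) \<le> norm (\<psi> x * v x)"
        using mult_right_mono[OF \<psi>[of x] v[of x]] v[of x] by (simp add: abs_mult)
    qed
  qed measurable
  assume R: "R \<ge> 0"
  have pos: "1 + R\<^sup>2 > 0" by (simp add: add_pos_nonneg)
  have i2: "integrable lborel (\<lambda>x. indicator {-R..R} x * (\<phi> x * v x))"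
    using integrable_mult_indicator[OF _ i, of "{-R..R}"] by simp
  have "\<bar>(\<integral>x. \<phi> x * v x \<partial>lborel) - (\<integral>x. indicator {-R..R} x * (\<phi> x * v x) \<partial>lborel)\<bar> =
     \<bar>\<integral>x. \<phi> x * v x - indicator {-R..R} x * (\<phi> x * v x) \<partial>lborel\<bar>"
    by (subst Bochner_Integration.integral_diff[OF i i2]) simp
  also have "\<dots> \<le> (\<integral>x. \<bar>\<phi> x * v x - indicator {-R..R} x * (\<phi> x * v x)\<bar> \<partial>lborel)"
    by (rule integral_abs_bound)
  also have "\<dots> \<le> (\<integral>x. (\<psi> x * v x) / (1 + R\<^sup>2) \<partial>lborel)"
  proof (rule integral_mono)
    show "integrable lborel (\<lambda>x. \<bar>\<phi> x * v x - indicator {-R..R} x * (\<phi> x * v x)\<bar>)"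
      using i i2 by (intro integrable_abs Bochner_Integration.integrable_diff)
    show "integrable lborel (\<lambda>x. (\<psi> x * v x) / (1 + R\<^sup>2))" using int by simp
    fix x
    show "\<bar>\<phi> x * v x - indicator {-R..R} x * (\<phi> x * v x)\<bar> \<le> (\<psi> x * v x) / (1 + R\<^sup>2)"
    proof (cases "x \<in> {-R..R}")
      case True
      have "0 \<le> \<psi> x" using \<psi>[of x] by linarith
      then show ?thesis using True v[of x] pos by simp
    next
      case False
      then have "R\<^sup>2 \<le> x\<^sup>2"
        using R by (intro abs_le_square_iff[THEN iffD1]) auto
      then have "\<bar>\<phi> x\<bar> * (1 + R\<^sup>2) \<le> \<psi> x"
        using \<phi>[of x] mult_left_mono[of "1 + R\<^sup>2" "1 + x\<^sup>2" "\<bar>\<phi> x\<bar>"] by linarith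
      then have "\<bar>\<phi> x\<bar> \<le> \<psi> x / (1 + R\<^sup>2)" using pos by (simp add: field_simps)
      from mult_right_mono[OF this v[of x]] show ?thesis
        using False v[of x] by (simp add: abs_mult)
    qed
  qed
  also have "\<dots> = (\<integral>x. \<psi> x * v x \<partial>lborel) / (1 + R\<^sup>2)" by simp
  also have "\<dots> \<le> C / (1 + R\<^sup>2)" using C pos by (simp add: divide_right_mono)
  finally show "\<bar>(\<integral>x. \<phi> x * v x \<partial>lborel) - (\<integral>x. indicator {-R..R} x * (\<phi> x * v x) \<partial>lborel)\<bar> \<le> C / (1 + R\<^sup>2)" .
qed

text \<open>Locally bounded pointwise convergence alone could lose mass at infinity. The uniform
  bound on the \<psi>-integrals passes to the limit density by Fatou, so the tails of both
  \<open>w k\<close> and \<open>v\<close> are at most C / (1 + R^2), while dominated convergence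
  applies on [-R, R]. Letting R grow removes the two tails.\<close>

lemma integral_limit_of_densities:
  fixes \<phi> \<psi> v :: "real \<Rightarrow> real" and w :: "nat \<Rightarrow> real \<Rightarrow> real"
  assumes cont: "continuous_on UNIV \<phi>" and meas\<psi>: "\<psi> \<in> borel_measurable borel"
    and measw: "\<And>k. w k \<in> borel_measurable borel" and w: "\<And>k x. w k x \<ge> 0"
    and lim: "\<And>x. (\<lambda>k. w k x) \<longlonglongrightarrow> v x"
    and bdd: "\<And>R. \<exists>B. \<forall>\<^sub>F k in sequentially. \<forall>x\<in>{-R..R}. w k x \<le> B"
    and \<phi>: "\<And>x. \<bar>\<phi> x\<bar> * (1 + x\<^sup>2) \<le> \<psi> x"
    and \<psi>: "\<forall>\<^sub>F k in sequentially. integrable lborel (\<lambda>x. \<psi> x * w k x) \<and> (\<integral>x. \<psi> x * w k x \<partial>lborel) \<le> C"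
    and c: "\<forall>\<^sub>F k in sequentially. (\<integral>x. \<phi> x * w k x \<partial>lborel) = c"
  shows "integrable lborel (\<lambda>x. \<phi> x * v x)" "(\<integral>x. \<phi> x * v x \<partial>lborel) = c"
proof -
  note [measurable] = meas\<psi> measw
  have meas\<phi>[measurable]: "\<phi> \<in> borel_measurable borel"
    using cont by (rule borel_measurable_continuous_onI)
  have measv[measurable]: "v \<in> borel_measurable borel"
    by (rule borel_measurable_LIMSEQ_real[OF lim measw])
  have v: "v x \<ge> 0" for x
    using lim[of x] by (rule LIMSEQ_le_const) (use w in auto)
  have \<psi>0: "\<psi> x \<ge> 0" for x
    using \<phi>[of x] by (rule order_trans[rotated]) simp
  have C0: "C \<ge> 0"
  proof -
    from \<psi> obtain k where "(\<integral>x. \<psi> x * w k x \<partial>lborel) \<le> C"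
      using eventually_happens' sequentially_bot by blast
    moreover have "(\<integral>x. \<psi> x * w k x \<partial>lborel) \<ge> 0" using \<psi>0 w by simp
    ultimately show ?thesis by simp
  qed
  have fatou: "(\<integral>\<^sup>+x. ennreal (\<psi> x * v x) \<partial>lborel) \<le> ennreal C"
  proof -
    have "(\<integral>\<^sup>+x. ennreal (\<psi> x * v x) \<partial>lborel) = (\<integral>\<^sup>+x. liminf (\<lambda>k. ennreal (\<psi> x * w k x)) \<partial>lborel)"
    proof (rule nn_integral_cong)
      fix x
      have "(\<lambda>k. ennreal (\<psi> x * w k x)) \<longlonglongrightarrow> ennreal (\<psi> x * v x)"
        by (intro tendsto_ennrealI tendsto_intros lim)
      then show "ennreal (\<psi> x * v x) = liminf (\<lambda>k. ennreal (\<psi> x * w k x))"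
        by (simp add: lim_imp_Liminf)
    qed
    also have "\<dots> \<le> liminf (\<lambda>k. \<integral>\<^sup>+x. ennreal (\<psi> x * w k x) \<partial>lborel)"
      by (rule nn_integral_liminf) measurable
    also have "\<dots> \<le> ennreal C"
    proof (rule Liminf_le)
      show "\<forall>\<^sub>F k in sequentially. (\<integral>\<^sup>+x. ennreal (\<psi> x * w k x) \<partial>lborel) \<le> ennreal C"
        using \<psi>
      proof eventually_elim
        case (elim k)
        then have "(\<integral>\<^sup>+x. ennreal (\<psi> x * w k x) \<partial>lborel) = ennreal (\<integral>x. \<psi> x * w k x \<partial>lborel)"
          using \<psi>0 w by (intro nn_integral_eq_integral) auto
        then show ?case using elim by (simp add: ennreal_leI)
      qed
    qed simp
    finally show ?thesis .
  qed
  have int\<psi>: "integrable lborel (\<lambda>x. \<psi> x * v x)"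
    using fatou \<psi>0 v by (intro integrableI_nonneg) (auto intro: le_less_trans)
  have int\<psi>C: "(\<integral>x. \<psi> x * v x \<partial>lborel) \<le> C"
    using fatou nn_integral_eq_integral[OF int\<psi>] \<psi>0 v C0 by (simp add: ennreal_le_iff)
  note tv = weighted_tail_bound[OF meas\<phi> measv v \<phi> int\<psi> int\<psi>C]
  show "integrable lborel (\<lambda>x. \<phi> x * v x)" by (rule tv)
  have key: "\<bar>(\<integral>x. \<phi> x * v x \<partial>lborel) - c\<bar> \<le> 2 * (C / (1 + R\<^sup>2))" if R: "R \<ge> 0" for R
  proof -
    let ?I = "\<lambda>v. \<integral>x. indicator {-R..R} x * (\<phi> x * v x) \<partial>lborel"
    obtain B where B: "\<forall>\<^sub>F k in sequentially. \<forall>x\<in>{-R..R}. w k x \<le> B" using bdd by blast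
    then obtain k0 where k0: "\<And>k x. k \<ge> k0 \<Longrightarrow> x \<in> {-R..R} \<Longrightarrow> w k x \<le> B"
      unfolding eventually_sequentially by blast
    have "(\<lambda>k. ?I (w (k + k0))) \<longlonglongrightarrow> ?I v"
    proof (rule integral_dominated_convergence[where w = "\<lambda>x. indicator {-R..R} x *\<^sub>R (\<bar>\<phi> x\<bar> * B)"])
      have "continuous_on {-R..R} (\<lambda>x. \<bar>\<phi> x\<bar> * B)"
        by (intro continuous_intros continuous_on_subset[OF cont]) auto
      from borel_integrable_compact[OF _ this]
      show "integrable lborel (\<lambda>x. indicator {-R..R} x *\<^sub>R (\<bar>\<phi> x\<bar> * B))"
        by (simp add: set_integrable_def)
      show "AE x in lborel. (\<lambda>k. indicator {-R..R} x * (\<phi> x * w (k + k0) x)) \<longlonglongrightarrow> indicator {-R..R} x * (\<phi> x * v x)"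
        by (intro AE_I2 tendsto_intros LIMSEQ_ignore_initial_segment lim)
      show "AE x in lborel. norm (indicator {-R..R} x * (\<phi> x * w (k + k0) x)) \<le> indicator {-R..R} x *\<^sub>R (\<bar>\<phi> x\<bar> * B)" for k
        using k0[of "k + k0"] w by (auto intro!: AE_I2 mult_left_mono simp: indicator_def abs_mult)
    qed measurable
    then have "(\<lambda>k. ?I (w k)) \<longlonglongrightarrow> ?I v" by (rule LIMSEQ_offset)
    then have "(\<lambda>k. \<bar>c - ?I (w k)\<bar>) \<longlonglongrightarrow> \<bar>c - ?I v\<bar>"
      by (intro tendsto_intros)
    moreover have "\<forall>\<^sub>F k in sequentially. \<bar>c - ?I (w k)\<bar> \<le> C / (1 + R\<^sup>2)"
      using \<psi> c
    proof eventually_elim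
      case (elim k)
      then show ?case using weighted_tail_bound(2)[OF meas\<phi> measw w \<phi> _ _ R, of k C] by simp
    qed
    ultimately have "\<bar>c - ?I v\<bar> \<le> C / (1 + R\<^sup>2)"
      by (rule tendsto_upperbound) simp
    with tv(2)[OF R] show ?thesis by linarith
  qed
  have "\<bar>(\<integral>x. \<phi> x * v x \<partial>lborel) - c\<bar> \<le> 0"
  proof (rule tendsto_lowerbound)
    show "((\<lambda>R::real. 2 * (C / (1 + R\<^sup>2))) \<longlongrightarrow> 0) at_top"
      by real_asymp
    show "\<forall>\<^sub>F R in at_top. \<bar>(\<integral>x. \<phi> x * v x \<partial>lborel) - c\<bar> \<le> 2 * (C / (1 + R\<^sup>2))"
      using eventually_ge_at_top[of 0] by eventually_elim (rule key)
  qed simp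
  then show "(\<integral>x. \<phi> x * v x \<partial>lborel) = c" by simp
qed

lemma (in jacobi) orth_measure_limit:
  fixes w :: "nat \<Rightarrow> real \<Rightarrow> real"
  assumes measw: "\<And>k. w k \<in> borel_measurable borel" and w: "\<And>k x. w k x \<ge> 0"
    and lim: "\<And>x. (\<lambda>k. w k x) \<longlonglongrightarrow> v x"
    and bdd: "\<And>R. \<exists>B. \<forall>\<^sub>F k in sequentially. \<forall>x\<in>{-R..R}. w k x \<le> B"
    and gram: "\<And>i j. \<forall>\<^sub>F k in sequentially. integrable lborel (\<lambda>x. w k x * (p i x * p j x)) \<and>
       (\<integral>x. w k x * (p i x * p j x) \<partial>lborel) = of_bool (i = j)"
  shows "is_orth_measure a b (density lborel (\<lambda>x. ennreal (v x)))"
proof -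
  note [measurable] = measw
  have measv[measurable]: "v \<in> borel_measurable borel"
    by (rule borel_measurable_LIMSEQ_real[OF lim measw])
  have v: "v x \<ge> 0" for x
    using lim[of x] by (rule LIMSEQ_le_const) (use w in auto)
  \<comment> \<open>\<psi> dominates p_i^2 (1 + x^2): x p_i is expanded by the recurrence, and 3
    comes from (r + s + t)^2 <= 3 (r^2 + s^2 + t^2). So the higher moments that control the tails
    need only the norms of p_{i-1}, p_i and p_{i+1}, and \<open>C\<close> is obtained by replacing
    each squared norm by 1.\<close>
  define \<psi> where "\<psi> i x = (p i x)\<^sup>2 + 3 * ((a (i-1) * pm i x)\<^sup>2 + (b i * p i x)\<^sup>2 + (a i * p (Suc i) x)\<^sup>2)" for i x
  define C where "C i = 1 + 3 * ((a (i-1))\<^sup>2 + (b i)\<^sup>2 + (a i)\<^sup>2)" for i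
  have \<psi>_ge: "(p i x)\<^sup>2 * (1 + x\<^sup>2) \<le> \<psi> i x" for i x
  proof -
    have sq: "(r + s + t)\<^sup>2 \<le> 3 * (r\<^sup>2 + s\<^sup>2 + t\<^sup>2)" for r s t :: real
      using zero_le_power2[of "r - s"] zero_le_power2[of "r - t"] zero_le_power2[of "s - t"]
      by (simp add: power2_eq_square algebra_simps)
    have "(p i x)\<^sup>2 * (1 + x\<^sup>2) = (p i x)\<^sup>2 + (x * p i x)\<^sup>2"
      by (simp add: power2_eq_square algebra_simps)
    then show ?thesis
      using sq[of "a (i-1) * pm i x" "b i * p i x" "a i * p (Suc i) x"]
      unfolding p_rec \<psi>_def by linarith
  qed
  have \<psi>_int: "\<forall>\<^sub>F k in sequentially. integrable lborel (\<lambda>x. \<psi> i x * w k x) \<and> (\<integral>x. \<psi> i x * w k x \<partial>lborel) \<le> C i" for i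
    using gram[of i i] gram[of "Suc i" "Suc i"] gram[of "i - 1" "i - 1"]
  proof eventually_elim
    case (elim k)
    \<comment> \<open>For i = 0 the term with \<open>pm\<close> is 0, whereas \<open>p (i-1)\<close>
      would read as p_0.\<close>
    define s where "s = (if i = 0 then 0 else 3 * (a (i-1))\<^sup>2)"
    have eq: "(\<lambda>x. \<psi> i x * w k x) = (\<lambda>x. s * (w k x * (p (i-1) x * p (i-1) x)) +
      ((1 + 3 * (b i)\<^sup>2) * (w k x * (p i x * p i x)) + (3 * (a i)\<^sup>2) * (w k x * (p (Suc i) x * p (Suc i) x))))"
      by (cases i) (auto simp: \<psi>_def s_def power2_eq_square algebra_simps simp del: orthp.simps)
    have "has_bochner_integral lborel (\<lambda>x. \<psi> i x * w k x) (s * 1 + ((1 + 3 * (b i)\<^sup>2) * 1 + (3 * (a i)\<^sup>2) * 1))"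
      unfolding eq using elim
      by (intro has_bochner_integral_add has_bochner_integral_mult_right) (auto simp: has_bochner_integral_iff simp del: orthp.simps)
    then show ?case by (auto simp: has_bochner_integral_iff s_def C_def)
  qed
  have ij: "integrable lborel (\<lambda>x. (p i x * p j x) * v x)" "(\<integral>x. (p i x * p j x) * v x \<partial>lborel) = of_bool (i = j)" for i j
  proof -
    have 1: "\<bar>p i x * p j x\<bar> * (1 + x\<^sup>2) \<le> \<psi> i x + \<psi> j x" for x
    proof -
      have "\<bar>p i x * p j x\<bar> \<le> (p i x)\<^sup>2 + (p j x)\<^sup>2"
        using sum_squares_bound[of "\<bar>p i x\<bar>" "\<bar>p j x\<bar>"] mult_nonneg_nonneg[OF abs_ge_zero abs_ge_zero, of "p i x" "p j x"]
        unfolding abs_mult mult.assoc power2_abs by linarith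
      then have "\<bar>p i x * p j x\<bar> * (1 + x\<^sup>2) \<le> ((p i x)\<^sup>2 + (p j x)\<^sup>2) * (1 + x\<^sup>2)"
        by (intro mult_right_mono) auto
      also have "\<dots> \<le> \<psi> i x + \<psi> j x"
        using \<psi>_ge[of i x] \<psi>_ge[of j x] by (simp only: distrib_right)
      finally show ?thesis .
    qed
    have 2: "\<forall>\<^sub>F k in sequentially. integrable lborel (\<lambda>x. (\<psi> i x + \<psi> j x) * w k x) \<and> (\<integral>x. (\<psi> i x + \<psi> j x) * w k x \<partial>lborel) \<le> C i + C j"
      using \<psi>_int[of i] \<psi>_int[of j] by eventually_elim (simp add: distrib_right)
    have 3: "\<forall>\<^sub>F k in sequentially. (\<integral>x. (p i x * p j x) * w k x \<partial>lborel) = of_bool (i = j)"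
      using gram[of i j] by eventually_elim (simp add: mult.commute)
    have 4: "(\<lambda>x. \<psi> i x + \<psi> j x) \<in> borel_measurable borel"
      unfolding \<psi>_def orthp_prev_def by measurable
    have 5: "continuous_on UNIV (\<lambda>x. p i x * p j x)" by (intro continuous_intros)
    show "integrable lborel (\<lambda>x. (p i x * p j x) * v x)" "(\<integral>x. (p i x * p j x) * v x \<partial>lborel) = of_bool (i = j)"
      using integral_limit_of_densities[OF 5 4 measw w lim bdd 1 2 3] by auto
  qed
  have "prob_space (density lborel (\<lambda>x. ennreal (v x)))"
  proof
    have "emeasure (density lborel (\<lambda>x. ennreal (v x))) (space (density lborel (\<lambda>x. ennreal (v x)))) = (\<integral>\<^sup>+x. ennreal (v x) \<partial>lborel)"
      by (simp add: emeasure_density)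
    also have "\<dots> = 1"
      using ij[of 0 0] v by (subst nn_integral_eq_integral) auto
    finally show "emeasure (density lborel (\<lambda>x. ennreal (v x))) (space (density lborel (\<lambda>x. ennreal (v x)))) = 1" .
  qed
  then show ?thesis unfolding is_orth_measure_def
    using ij v by (auto simp: integrable_density integral_density mult.commute)
qed

subsection \<open>Turan determinants as quadratic forms\<close>

lemma residue_class_bounded:
  fixes f :: "nat \<Rightarrow> real"
  assumes "N \<ge> 1" and lim: "\<And>i. i < N \<Longrightarrow> (\<lambda>n. f (n * N + i)) \<longlonglongrightarrow> L i"
  obtains B where "B > 0" "\<And>n. \<bar>f n\<bar> \<le> B"
proof -
  have "\<exists>B. \<forall>n. \<bar>f (n * N + i)\<bar> \<le> B" if "i < N" for i
    using convergent_imp_Bseq[OF convergentI[OF lim[OF that]]] by (auto simp: Bseq_def)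
  then obtain B where B: "\<And>i n. i < N \<Longrightarrow> \<bar>f (n * N + i)\<bar> \<le> B i" by metis
  have "\<bar>f n\<bar> \<le> (\<Sum>i<N. \<bar>B i\<bar>) + 1" for n
  proof -
    have i: "n mod N < N" using assms(1) by simp
    have "\<bar>f n\<bar> \<le> B (n mod N)" using B[OF i, of "n div N"] by simp
    also have "\<dots> \<le> \<bar>B (n mod N)\<bar>" by simp
    also have "\<dots> \<le> (\<Sum>i<N. \<bar>B i\<bar>)" using i by (intro member_le_sum) auto
    finally show ?thesis by simp
  qed
  moreover have "(\<Sum>i<N. \<bar>B i\<bar>) + 1 > 0" by (intro add_nonneg_pos sum_nonneg) auto
  ultimately show ?thesis using that by blast
qed

text \<open>Shifting a partial sum T by N bounds it by its first N terms plus \<theta> T, which can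
  be solved for T since \<theta> < 1. It serves to exclude that a_{n+N} / a_n has a limit above
  1.\<close>

lemma summable_of_step_ratio:
  fixes u :: "nat \<Rightarrow> real"
  assumes u: "\<And>n. u n \<ge> 0" and \<theta>: "0 \<le> \<theta>" "\<theta> < 1" and step: "\<And>n. n \<ge> M \<Longrightarrow> u (n + N) \<le> \<theta> * u n"
  shows "summable u"
proof -
  define v where "v n = u (n + M)" for n
  have v: "v n \<ge> 0" "v (n + N) \<le> \<theta> * v n" for n
    using u step[of "n + M"] by (auto simp: v_def add_ac)
  have split: "(\<Sum>n<K + N. v n) = (\<Sum>n<N. v n) + (\<Sum>n<K. v (n + N))" for K
    by (induction K) auto
  have "summable v"
  proof (rule summableI_nonneg_bounded)
    fix K
    have "(\<Sum>n<K. v n) \<le> (\<Sum>n<K + N. v n)" using v by (intro sum_mono2) auto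
    also have "\<dots> \<le> (\<Sum>n<N. v n) + (\<Sum>n<K. \<theta> * v n)"
      unfolding split using v by (intro add_left_mono sum_mono) auto
    also have "\<dots> = (\<Sum>n<N. v n) + \<theta> * (\<Sum>n<K. v n)" by (simp add: sum_distrib_left)
    finally have "(1 - \<theta>) * (\<Sum>n<K. v n) \<le> (\<Sum>n<N. v n)" by (simp add: algebra_simps)
    then show "(\<Sum>n<K. v n) \<le> (\<Sum>n<N. v n) / (1 - \<theta>)" using \<theta> by (simp add: field_simps)
  qed (use v in auto)
  then show ?thesis unfolding v_def by (rule summable_iff_shift[THEN iffD1])
qed

text \<open>Since the steps are small relative to S_n itself, from some index L on all S_n stay
  within |S_L| / 2 of S_L. This keeps them away from 0 and also bounds them, so the increments are
  dominated by a multiple of \<open>e\<close> and the Weierstrass test applies.\<close>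

lemma uniform_limit_multiplicative_steps:
  fixes S :: "nat \<Rightarrow> real \<Rightarrow> real" and K :: "real set"
  assumes K: "compact K" and cont: "\<And>n. continuous_on K (S n)"
    and nz: "\<And>n x. n \<ge> M \<Longrightarrow> x \<in> K \<Longrightarrow> S n x \<noteq> 0"
    and step: "\<And>n x. n \<ge> M \<Longrightarrow> x \<in> K \<Longrightarrow> \<bar>S (Suc n) x - S n x\<bar> \<le> e n * \<bar>S n x\<bar>"
    and e: "summable e" "\<And>n. e n \<ge> 0"
  obtains g c M' where "uniform_limit K S g sequentially" "c > 0"
    "\<And>n x. n \<ge> M' \<Longrightarrow> x \<in> K \<Longrightarrow> c \<le> \<bar>S n x\<bar>"
proof -
  \<comment> \<open>In \<open>close\<close> each increment is measured against |S_L| using |S_n| <=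
    2 |S_L|, which doubles the sum of \<open>e\<close>; a tail of 1/4 therefore yields the relative
    deviation 1/2.\<close>
  obtain M0 where M0: "\<And>m n. m \<ge> M0 \<Longrightarrow> norm (sum e {m..<n}) < 1/4"
    using e(1) unfolding summable_Cauchy by (metis zero_less_divide_1_iff zero_less_numeral)
  define L where "L = max M M0"
  have \<sigma>: "sum e {L..<n} \<le> 1/4" for n using M0[of L n] by (simp add: L_def)
  have close: "\<bar>S n x - S L x\<bar> \<le> 2 * sum e {L..<n} * \<bar>S L x\<bar>" if "n \<ge> L" "x \<in> K" for n x
    using that(1)
  proof (induction rule: dec_induct)
    case (step n)
    have "2 * sum e {L..<n} * \<bar>S L x\<bar> \<le> 1 * \<bar>S L x\<bar>"
      using \<sigma>[of n] by (intro mult_right_mono) auto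
    then have "\<bar>S n x\<bar> \<le> 2 * \<bar>S L x\<bar>" using step.IH by linarith
    then have "e n * \<bar>S n x\<bar> \<le> e n * (2 * \<bar>S L x\<bar>)" using e(2) by (intro mult_left_mono) auto
    then have "\<bar>S (Suc n) x - S n x\<bar> \<le> 2 * e n * \<bar>S L x\<bar>"
      using assms(4)[of n x] step that by (simp add: L_def)
    moreover have "2 * sum e {L..<Suc n} * \<bar>S L x\<bar> = 2 * sum e {L..<n} * \<bar>S L x\<bar> + 2 * e n * \<bar>S L x\<bar>"
      using step by (simp add: algebra_simps)
    ultimately show ?case using step.IH by linarith
  qed simp
  have half: "\<bar>S n x - S L x\<bar> \<le> \<bar>S L x\<bar> / 2" if "n \<ge> L" "x \<in> K" for n x
  proof -
    have "2 * sum e {L..<n} * \<bar>S L x\<bar> \<le> 1/2 * \<bar>S L x\<bar>"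
      using \<sigma>[of n] by (intro mult_right_mono) auto
    then show ?thesis using close[OF that] by linarith
  qed
  obtain c B where c: "c > 0" "\<And>x. x \<in> K \<Longrightarrow> c \<le> \<bar>S L x\<bar>" and B: "\<And>x. x \<in> K \<Longrightarrow> \<bar>S L x\<bar> \<le> B"
  proof (cases "K = {}")
    case True
    then show ?thesis using that[of 1 0] by auto
  next
    case False
    have cS: "continuous_on K (\<lambda>x. \<bar>S L x\<bar>)" by (intro continuous_intros cont)
    from continuous_attains_inf[OF K False cS] obtain y where y: "y \<in> K" "\<And>x. x \<in> K \<Longrightarrow> \<bar>S L y\<bar> \<le> \<bar>S L x\<bar>" by blast
    from continuous_attains_sup[OF K False cS] obtain z where z: "z \<in> K" "\<And>x. x \<in> K \<Longrightarrow> \<bar>S L x\<bar> \<le> \<bar>S L z\<bar>" by blast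
    show ?thesis using that[of "\<bar>S L y\<bar>" "\<bar>S L z\<bar>"] y z nz[of L y] by (auto simp: L_def)
  qed
  define f where "f k x = S (Suc k + L) x - S (k + L) x" for k x
  have "uniform_limit K (\<lambda>n x. \<Sum>k<n. f k x) (\<lambda>x. suminf (\<lambda>k. f k x)) sequentially"
  proof (rule Weierstrass_m_test)
    show "summable (\<lambda>k. e (k + L) * (2 * B))"
      by (intro summable_mult2 summable_ignore_initial_segment e)
    fix k x assume x: "x \<in> K"
    have "\<bar>S (k + L) x - S L x\<bar> \<le> \<bar>S L x\<bar> / 2" using half[of "k + L" x] x by simp
    then have "\<bar>S (k + L) x\<bar> \<le> 2 * B" using B[OF x] by linarith
    then have "e (k + L) * \<bar>S (k + L) x\<bar> \<le> e (k + L) * (2 * B)" using e(2) by (intro mult_left_mono) auto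
    moreover have "M \<le> k + L" by (simp add: L_def)
    ultimately show "norm (f k x) \<le> e (k + L) * (2 * B)"
      using step[of "k + L" x] x by (simp add: f_def)
  qed
  then have "uniform_limit K (\<lambda>n x. (\<Sum>k<n. f k x) + S L x) (\<lambda>x. suminf (\<lambda>k. f k x) + S L x) sequentially"
    by (intro uniform_limit_intros)
  moreover have "(\<Sum>k<n. f k x) + S L x = S (n + L) x" for n x
    by (induction n) (auto simp: f_def)
  ultimately have "uniform_limit K (\<lambda>n. S (n + L)) (\<lambda>x. suminf (\<lambda>k. f k x) + S L x) sequentially"
    by simp
  then have "uniform_limit K S (\<lambda>x. suminf (\<lambda>k. f k x) + S L x) sequentially"
    unfolding uniform_limit_iff
    by (subst (asm) eventually_sequentially_seg[where P = "\<lambda>n. \<forall>x\<in>K. dist (S n x) (suminf (\<lambda>k. f k x) + S L x) < _" and k = L])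
  moreover have "c / 2 \<le> \<bar>S n x\<bar>" if "n \<ge> L" "x \<in> K" for n x
    using half[OF that] c(2)[OF that(2)] by linarith
  ultimately show ?thesis using that[of _ "c / 2" L] c(1) by auto
qed

text \<open>This is det (X v, v) for the column v = (u, w). Its discriminant as a binary quadratic
  form is \<open>discr X\<close>.\<close>

definition wedge_form :: "real^2^2 \<Rightarrow> real \<Rightarrow> real \<Rightarrow> real" where
  "wedge_form X u w = (X$1$1 * u + X$1$2 * w) * w - (X$2$1 * u + X$2$2 * w) * u"

lemma discr_eq: "discr X = (X$1$1 - X$2$2)\<^sup>2 + 4 * X$1$2 * X$2$1"
  by (simp add: discr_def trace_def sum_2 det_2 power2_eq_square algebra_simps)

lemma wedge_form_perturb:
  assumes "\<And>i j. \<bar>X$i$j - Y$i$j\<bar> \<le> e"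
  shows "\<bar>wedge_form X u w - wedge_form Y u w\<bar> \<le> 2 * e * (u\<^sup>2 + w\<^sup>2)"
proof -
  have *: "\<bar>(X$i$j - Y$i$j) * s\<bar> \<le> e * \<bar>s\<bar>" for i j s
    unfolding abs_mult by (intro mult_right_mono assms) auto
  have e: "e \<ge> 0" using assms[of 1 1] by linarith
  have "wedge_form X u w - wedge_form Y u w = (X$1$1 - Y$1$1) * (u * w) + (X$1$2 - Y$1$2) * w\<^sup>2
      - (X$2$1 - Y$2$1) * u\<^sup>2 - (X$2$2 - Y$2$2) * (u * w)"
    by (simp add: wedge_form_def power2_eq_square algebra_simps)
  then have "\<bar>wedge_form X u w - wedge_form Y u w\<bar> \<le> e * \<bar>u * w\<bar> + e * w\<^sup>2 + e * u\<^sup>2 + e * \<bar>u * w\<bar>"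
    using *[of 1 1 "u * w"] *[of 1 2 "w\<^sup>2"] *[of 2 1 "u\<^sup>2"] *[of 2 2 "u * w"] by simp
  moreover have "e * (2 * \<bar>u * w\<bar>) \<le> e * (u\<^sup>2 + w\<^sup>2)"
    using sum_squares_bound[of "\<bar>u\<bar>" "\<bar>w\<bar>"] e by (intro mult_left_mono) (auto simp: abs_mult)
  ultimately show ?thesis by (simp add: algebra_simps)
qed

text \<open>Writing the form as Q = A w^2 + B u w + C u^2 with B^2 - 4 A C = -\<delta>, completing
  the square once in each variable gives 4 A Q >= \<delta> u^2 and 4 C Q >= \<delta> w^2. Their sum
  produces the constant.\<close>

lemma wedge_form_definite:
  assumes "discr X < 0"
  obtains c where "c > 0" "\<And>u w. c * (u\<^sup>2 + w\<^sup>2) \<le> \<bar>wedge_form X u w\<bar>"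
proof -
  let ?A = "X$1$2" and ?B = "X$1$1 - X$2$2" and ?C = "- X$2$1"
  define \<delta> where "\<delta> = - discr X"
  have \<delta>: "\<delta> > 0" "\<delta> = 4 * ?A * ?C - ?B\<^sup>2" using assms by (auto simp: \<delta>_def discr_eq)
  have A: "?A \<noteq> 0" using \<delta> by (metis diff_0 less_le_not_le mult_eq_0_iff neg_le_0_iff_le zero_le_power2 mult_zero_left mult_zero_right)
  have "\<delta> / (4 * (\<bar>?A\<bar> + \<bar>?C\<bar>)) * (u\<^sup>2 + w\<^sup>2) \<le> \<bar>wedge_form X u w\<bar>" for u w
  proof -
    let ?Q = "wedge_form X u w"
    have "4 * ?A * ?Q = (2 * ?A * w + ?B * u)\<^sup>2 + \<delta> * u\<^sup>2"
      unfolding \<delta>(2) wedge_form_def by (simp add: power2_eq_square algebra_simps)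
    then have "\<delta> * u\<^sup>2 \<le> 4 * ?A * ?Q" by simp
    also have "\<dots> \<le> \<bar>4 * ?A * ?Q\<bar>" by simp
    finally have 1: "\<delta> * u\<^sup>2 \<le> 4 * \<bar>?A\<bar> * \<bar>?Q\<bar>" by (simp add: abs_mult)
    have "4 * ?C * ?Q = (2 * ?C * u + ?B * w)\<^sup>2 + \<delta> * w\<^sup>2"
      unfolding \<delta>(2) wedge_form_def by (simp add: power2_eq_square algebra_simps)
    then have "\<delta> * w\<^sup>2 \<le> 4 * ?C * ?Q" by simp
    also have "\<dots> \<le> \<bar>4 * ?C * ?Q\<bar>" by simp
    finally have 2: "\<delta> * w\<^sup>2 \<le> 4 * \<bar>?C\<bar> * \<bar>?Q\<bar>" by (simp add: abs_mult)
    have "\<delta> * (u\<^sup>2 + w\<^sup>2) \<le> (4 * (\<bar>?A\<bar> + \<bar>?C\<bar>)) * \<bar>?Q\<bar>"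
      using 1 2 by (simp add: algebra_simps)
    moreover have "4 * (\<bar>?A\<bar> + \<bar>?C\<bar>) > 0" using A by simp
    ultimately show ?thesis by (simp add: field_simps)
  qed
  moreover have "\<delta> / (4 * (\<bar>?A\<bar> + \<bar>?C\<bar>)) > 0" using \<delta> A by simp
  ultimately show ?thesis using that by blast
qed

lemma transfer_mat_nth [simp]:
  "transfer_mat r q $ 1 $ 1 = 0" "transfer_mat r q $ 1 $ 2 = 1"
  "transfer_mat r q $ 2 $ 1 = - r" "transfer_mat r q $ 2 $ 2 = - q"
  by (simp_all add: transfer_mat_def)

text \<open>The filter is arbitrary so that a product filter can later make the convergence uniform
  in x.\<close>

lemma ordprod_tendsto:
  assumes "\<And>l. l < m \<Longrightarrow> ((\<lambda>t. r t l) \<longlongrightarrow> r' l) G" "\<And>l. l < m \<Longrightarrow> ((\<lambda>t. q t l) \<longlongrightarrow> q' l) G"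
  shows "((\<lambda>t. ordprod (\<lambda>l. transfer_mat (r t l) (q t l)) m $ i $ j) \<longlongrightarrow>
      ordprod (\<lambda>l. transfer_mat (r' l) (q' l)) m $ i $ j) G"
  using assms
proof (induction m arbitrary: i j)
  case (Suc m)
  have "((\<lambda>t. transfer_mat (r t m) (q t m) $ i $ k) \<longlongrightarrow> transfer_mat (r' m) (q' m) $ i $ k) G" for k
    using exhaust_2[of i] exhaust_2[of k] Suc.prems by (elim disjE) (simp_all add: tendsto_minus)
  then show ?case
    using Suc by (auto simp: matrix_matrix_mult_def sum_2 intro!: tendsto_add tendsto_mult)
qed simp

section \<open>Transfer matrices and the one-step identity for Turan determinants\<close>

context jacobi
begin

text \<open>The coefficients of one transfer step; \<rho> is its determinant. At n = 0 truncated
  subtraction reads a_{-1} as \<open>a 0\<close>, which is consistent because it multiplies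
  \<open>pm 0 x = 0\<close> in the recurrence.\<close>

abbreviation "\<rho> n \<equiv> a (n - 1) / a n"
abbreviation "s n x \<equiv> (x - b n) / a n"

definition "V n x = (pm n x)\<^sup>2 + (p n x)\<^sup>2"

lemma p_Suc: "p (Suc n) x = s n x * p n x - \<rho> n * pm n x"
  using p_rec[of x n] by (simp add: field_simps del: orthp.simps)

lemma V_pos: "V n x > 0"
proof -
  have "pm n x \<noteq> 0 \<or> p n x \<noteq> 0"
  proof (induction n)
    case (Suc n)
    then show ?case using p_rec[of x n] a_pos[of "n - 1"] by (auto simp del: orthp.simps)
  qed simp
  then show ?thesis by (auto simp: V_def sum_power2_gt_zero_iff)
qed

lemma V_ge: "(pm n x)\<^sup>2 \<le> V n x" "(p n x)\<^sup>2 \<le> V n x"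
  by (simp_all add: V_def)

lemma transfer_iterate:
  defines "X \<equiv> \<lambda>n x. ordprod (\<lambda>j. transfer_mat (\<rho> (n + j)) ((b (n + j) - x) / a (n + j)))"
  shows "pm (n + m) x = X n x m $ 1 $ 1 * pm n x + X n x m $ 1 $ 2 * p n x"
    and "p (n + m) x = X n x m $ 2 $ 1 * pm n x + X n x m $ 2 $ 2 * p n x"
proof (induction m)
  case 0
  show "pm (n + 0) x = X n x 0 $ 1 $ 1 * pm n x + X n x 0 $ 1 $ 2 * p n x"
    and "p (n + 0) x = X n x 0 $ 2 $ 1 * pm n x + X n x 0 $ 2 $ 2 * p n x"
    by (simp_all add: X_def mat_def)
next
  case (Suc m)
  show "pm (n + Suc m) x = X n x (Suc m) $ 1 $ 1 * pm n x + X n x (Suc m) $ 1 $ 2 * p n x"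
    using Suc by (simp add: X_def matrix_matrix_mult_def sum_2)
  have "s (n + m) x = - ((b (n + m) - x) / a (n + m))"
    by (simp add: diff_divide_distrib)
  then have "p (n + Suc m) x = - ((b (n + m) - x) / a (n + m)) * p (n + m) x - \<rho> (n + m) * pm (n + m) x"
    using p_Suc[of "n + m" x] by (simp del: orthp.simps)
  then show "p (n + Suc m) x = X n x (Suc m) $ 2 $ 1 * pm n x + X n x (Suc m) $ 2 $ 2 * p n x"
    unfolding Suc by (simp add: X_def matrix_matrix_mult_def sum_2 algebra_simps del: orthp.simps)
qed

lemma turan_alt: "N \<ge> 1 \<Longrightarrow> turan a b N n x = p n x * pm (n + N) x - pm n x * p (n + N) x"
  by (simp add: turan_def orthp_prev_def)

lemma turan_wedge_form:
  assumes "N \<ge> 1"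
  shows "turan a b N n x = wedge_form (ordprod (\<lambda>j. transfer_mat (\<rho> (n + j)) ((b (n + j) - x) / a (n + j))) N) (pm n x) (p n x)"
  unfolding turan_alt[OF assms] transfer_iterate[of n N x] wedge_form_def by (simp add: mult.commute)

text \<open>Were the coefficients at n and n + N equal, one transfer step would act on both columns
  of the determinant and multiply it by \<rho> n. The correction terms contain exactly the
  differences over one period.\<close>

lemma turan_Suc:
  assumes "N \<ge> 1"
  shows "turan a b N (Suc n) x = \<rho> n * turan a b N n x + (s n x - s (n + N) x) * (p n x * p (n + N) x)
     + (\<rho> (n + N) - \<rho> n) * (p n x * pm (n + N) x)"
  unfolding turan_alt[OF assms] add_Suc pm_simps p_Suc by (simp add: algebra_simps)

end

subsection \<open>Convergence of the Turan determinants\<close>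

locale jacobi_periodic_limit = jacobi +
  fixes q r :: "nat \<Rightarrow> real" and N :: nat
  assumes N_pos: "N \<ge> 1"
    and var1: "finite_var N (\<lambda>n. 1 / a n)"
    and var2: "finite_var N (\<lambda>n. b n / a n)"
    and var3: "finite_var 1 (\<lambda>n. a (n + N) / a n)"
    and div: "\<not> summable (\<lambda>n. 1 / a n)"
    and lim_a: "(\<lambda>n. 1 / a n) \<longlonglongrightarrow> 0"
    and lim_q: "\<And>i. i < N \<Longrightarrow> (\<lambda>n. b (n * N + i) / a (n * N + i)) \<longlonglongrightarrow> q i"
    and lim_r: "\<And>i. i < N \<Longrightarrow> (\<lambda>n. a (n * N + i - 1) / a (n * N + i)) \<longlonglongrightarrow> r i"
    and r_pos: "\<And>i. i < N \<Longrightarrow> r i > 0"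
    and discr_neg: "discr (ordprod (\<lambda>j. transfer_mat (r j) (q j)) N) < 0"
begin

abbreviation "c n \<equiv> a (n + N) / a n"
abbreviation "D \<equiv> turan a b N"
abbreviation "S n x \<equiv> a (n + N - 1) * D n x"
abbreviation "F \<equiv> ordprod (\<lambda>j. transfer_mat (r j) (q j)) N"

lemma filterlim_mult_add: "filterlim (\<lambda>k. k * N + l) sequentially sequentially"
  using N_pos by (intro filterlim_subseq strict_monoI) simp

text \<open>The variation hypothesis supplies a limit l. If l < 1, then 1 / a_n eventually increases
  along steps of N and cannot tend to 0. If l > 1, it decays geometrically along steps of N and is
  summable, against \<open>div\<close>.\<close>

lemma c_tendsto_1: "c \<longlonglongrightarrow> 1"
proof -
  have "summable (\<lambda>n. norm (c (Suc n) - c n))"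
    using var3 by (simp add: finite_var_def)
  then have "summable (\<lambda>n. c (Suc n) - c n)" by (rule summable_norm_cancel)
  then have "convergent (\<lambda>n. \<Sum>k<n. c (Suc k) - c k)" by (simp add: summable_iff_convergent)
  also have "(\<lambda>n. \<Sum>k<n. c (Suc k) - c k) = (\<lambda>n. c n - c 0)"
    by (rule ext) (rule sum_lessThan_telescope[where f = c])
  finally have "convergent (\<lambda>n. c n - c 0)" .
  then obtain L where "(\<lambda>n. c n - c 0) \<longlonglongrightarrow> L" by (auto simp: convergent_def)
  from tendsto_add[OF this tendsto_const[of "c 0"]] obtain l where l: "c \<longlonglongrightarrow> l" by auto
  have "\<not> l < 1"
  proof
    assume "l < 1"
    with l have "\<forall>\<^sub>F n in sequentially. c n < 1" by (rule order_tendstoD)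
    then obtain M where M: "\<And>n. n \<ge> M \<Longrightarrow> c n < 1" by (auto simp: eventually_sequentially)
    have le: "1 / a n \<le> 1 / a (n + N)" if "n \<ge> M" for n
      using M[OF that] a_pos[of n] a_pos[of "n + N"] by (simp add: field_simps)
    have "1 / a M \<le> 1 / a (M + k * N)" for k
    proof (induction k)
      case (Suc k)
      show ?case using Suc le[of "M + k * N"] by (simp add: add_ac)
    qed simp
    moreover have "(\<lambda>k. 1 / a (M + k * N)) \<longlonglongrightarrow> 0"
      using filterlim_compose[OF lim_a filterlim_mult_add[of M]] by (simp add: add.commute)
    ultimately have "1 / a M \<le> 0" by (intro LIMSEQ_le_const) auto
    then show False using a_pos[of M] by (simp add: field_simps)
  qed
  moreover have "\<not> l > 1"
  proof
    assume "l > 1"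
    then obtain \<theta> where \<theta>: "1 < \<theta>" "\<theta> < l" using dense by blast
    from order_tendstoD(1)[OF l \<theta>(2)] obtain M where M: "\<And>n. n \<ge> M \<Longrightarrow> c n > \<theta>"
      by (auto simp: eventually_sequentially)
    have "summable (\<lambda>n. 1 / a n)"
    proof (rule summable_of_step_ratio[where \<theta> = "1 / \<theta>"])
      fix n assume "n \<ge> M"
      then have "\<theta> * a n < a (n + N)" using M[of n] a_pos[of n] by (simp add: pos_less_divide_eq)
      then show "1 / a (n + N) \<le> 1 / \<theta> * (1 / a n)"
        using frac_le[of 1 1 "\<theta> * a n" "a (n + N)"] a_pos[of n] \<theta> by simp
    qed (use a_pos \<theta> in \<open>auto simp: less_imp_le\<close>)
    then show False using div by simp
  qed
  ultimately have "l = 1" by linarith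
  then show ?thesis using l by simp
qed

lemma coefficient_bounds:
  obtains B where "B > 1" "\<And>n. \<rho> n \<le> B" "\<And>n. 1 / B \<le> \<rho> n" "\<And>n. \<bar>b n / a n\<bar> \<le> B" "\<And>n. 1 / a n \<le> B"
    "\<And>n. c n \<le> B" "\<And>n. 1 / B \<le> c n"
proof -
  have \<rho>pos: "\<rho> n > 0" and cpos: "c n > 0" for n using a_pos by auto
  obtain B1 where B1: "B1 > 0" "\<And>n. \<bar>\<rho> n\<bar> \<le> B1"
    using residue_class_bounded[OF N_pos, of \<rho> r] lim_r by auto
  obtain B2 where B2: "B2 > 0" "\<And>n. \<bar>1 / \<rho> n\<bar> \<le> B2"
    by (rule residue_class_bounded[OF N_pos, of "\<lambda>n. 1 / \<rho> n" "\<lambda>i. 1 / r i"])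
       (use lim_r r_pos in \<open>auto intro!: tendsto_divide simp del: divide_divide_eq_right simp: less_imp_neq[symmetric]\<close>)
  obtain B3 where B3: "B3 > 0" "\<And>n. \<bar>b n / a n\<bar> \<le> B3"
    using residue_class_bounded[OF N_pos, of "\<lambda>n. b n / a n" q] lim_q by auto
  have "Bseq (\<lambda>n. 1 / a n)" by (rule convergent_imp_Bseq[OF convergentI[OF lim_a]])
  moreover have "Bseq c" by (rule convergent_imp_Bseq[OF convergentI[OF c_tendsto_1]])
  moreover have "Bseq (\<lambda>n. 1 / c n)"
    by (rule convergent_imp_Bseq[OF convergentI[OF tendsto_divide[OF tendsto_const c_tendsto_1]]]) simp
  ultimately obtain B4 B5 B6 where B4: "\<And>n. \<bar>1 / a n\<bar> \<le> B4" and B5: "\<And>n. \<bar>c n\<bar> \<le> B5" and B6: "\<And>n. \<bar>1 / c n\<bar> \<le> B6"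
    unfolding Bseq_def real_norm_def by blast
  define B where "B = Max {B1, B2, B3, B4, B5, B6, 2}"
  have B: "B1 \<le> B" "B2 \<le> B" "B3 \<le> B" "B4 \<le> B" "B5 \<le> B" "B6 \<le> B" "2 \<le> B"
    unfolding B_def by (rule Max_ge; simp)+
  have inv: "1 / B \<le> t" if "t > 0" "\<bar>1 / t\<bar> \<le> B" for t
    using that B by (simp add: field_simps)
  show ?thesis
  proof (rule that[of B])
    show "1 / B \<le> \<rho> n" for n by (rule inv[OF \<rho>pos order_trans[OF B2(2) B(2)]])
    show "1 / B \<le> c n" for n by (rule inv[OF cpos order_trans[OF B6 B(6)]])
    show "\<rho> n \<le> B" for n using B1(2)[of n] B by linarith
    show "\<bar>b n / a n\<bar> \<le> B" for n using B3(2)[of n] B by linarith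
    show "1 / a n \<le> B" for n using B4[of n] B by linarith
    show "c n \<le> B" for n using B5[of n] B by linarith
  qed (use B in auto)
qed

lemma step_ratio_summable: "summable (\<lambda>n. \<bar>c (Suc n) / c n - 1\<bar>)"
proof -
  obtain B where B: "B > 1" "\<And>n. 1 / B \<le> c n" using coefficient_bounds by metis
  show ?thesis
  proof (rule summable_comparison_test)
    show "summable (\<lambda>n. B * \<bar>c (Suc n) - c n\<bar>)"
      using var3 by (intro summable_mult) (simp add: finite_var_def)
    have "\<bar>c (Suc n) / c n - 1\<bar> \<le> B * \<bar>c (Suc n) - c n\<bar>" for n
    proof -
      have cp: "c n > 0" using a_pos by simp
      define t where "t = c n"
      define t' where "t' = c (Suc n)"
      have t: "t > 0" "1 \<le> B * t" using cp B(2)[of n] B(1) by (auto simp: t_def field_simps)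
      have "t' / t - 1 = (t' - t) / t" using t by (simp add: field_simps)
      then have "\<bar>t' / t - 1\<bar> = \<bar>t' - t\<bar> / t" using t by (simp add: abs_divide)
      also have "\<dots> \<le> B * \<bar>t' - t\<bar>"
        using t mult_right_mono[OF t(2), of "\<bar>t' - t\<bar>"] by (simp add: field_simps)
      finally show ?thesis by (simp add: t_def t'_def)
    qed
    then show "\<exists>M. \<forall>n\<ge>M. norm \<bar>c (Suc n) / c n - 1\<bar> \<le> B * \<bar>c (Suc n) - c n\<bar>" by auto
  qed
qed

text \<open>The variation hypothesis concerns \<open>c\<close>, but \<rho>_{n+1+N} / \<rho>_{n+1} =
  c_n / c_{n+1}, so it transfers to \<rho> because both \<open>c\<close> and 1 / c are
  bounded.\<close>

lemma \<rho>_variation_summable: "summable (\<lambda>n. \<bar>\<rho> (n + N) - \<rho> n\<bar>)"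
proof -
  obtain B where B: "B > 1" "\<And>n. \<rho> n \<le> B" "\<And>n. 1 / B \<le> c n" "\<And>n. c n \<le> B" using coefficient_bounds by metis
  have "summable (\<lambda>n. \<bar>\<rho> (Suc n + N) - \<rho> (Suc n)\<bar>)"
  proof (rule summable_comparison_test)
    show "summable (\<lambda>n. B * (B * B) * \<bar>c (Suc n) / c n - 1\<bar>)"
      by (intro summable_mult step_ratio_summable)
    have "\<bar>\<rho> (Suc n + N) - \<rho> (Suc n)\<bar> \<le> B * (B * B) * \<bar>c (Suc n) / c n - 1\<bar>" for n
    proof -
      define \<kappa>' where "\<kappa>' = c (Suc n) / c n"
      have k: "\<kappa>' > 0" unfolding \<kappa>'_def using a_pos by simp
      have cn: "c n > 0" "c (Suc n) > 0" using a_pos by auto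
      have "1 / \<kappa>' = c n * (1 / c (Suc n))" by (simp add: \<kappa>'_def mult.commute)
      also have "\<dots> \<le> B * B"
      proof (rule mult_mono)
        have "1 / t \<le> B" if "1 / B \<le> t" "t > 0" for t
          using that B(1) by (simp add: field_simps)
        then show "1 / c (Suc n) \<le> B" using B(3) cn(2) .
        show "0 \<le> 1 / c (Suc n)" using cn(2) by (intro divide_nonneg_pos) auto
      qed (use B(1) B(4)[of n] in auto)
      finally have k2: "1 / \<kappa>' \<le> B * B" .
      have "\<rho> (Suc n + N) = \<rho> (Suc n) / \<kappa>'"
        unfolding \<kappa>'_def using a_pos by (simp add: field_simps)
      then have "\<rho> (Suc n + N) - \<rho> (Suc n) = \<rho> (Suc n) * ((1 / \<kappa>') * (1 - \<kappa>'))"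
        using k by (simp add: field_simps)
      then have "\<bar>\<rho> (Suc n + N) - \<rho> (Suc n)\<bar> = \<rho> (Suc n) * ((1 / \<kappa>') * \<bar>\<kappa>' - 1\<bar>)"
        using k a_pos[of n] a_pos[of "Suc n"] by (simp add: abs_mult abs_minus_commute)
      also have "\<dots> \<le> B * ((B * B) * \<bar>\<kappa>' - 1\<bar>)"
        using B(2)[of "Suc n"] k2 k B(1) by (intro mult_mono mult_right_mono) auto
      finally show ?thesis by (simp add: \<kappa>'_def mult.assoc)
    qed
    then show "\<exists>M. \<forall>n\<ge>M. norm \<bar>\<rho> (Suc n + N) - \<rho> (Suc n)\<bar> \<le> B * (B * B) * \<bar>c (Suc n) / c n - 1\<bar>" by auto
  qed
  then show ?thesis using summable_Suc_iff[of "\<lambda>n. \<bar>\<rho> (n + N) - \<rho> n\<bar>"] by simp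
qed

text \<open>As \<open>s n x\<close> is x / a_n - b_n / a_n, this majorises the change of both
  transfer coefficients over one period for all |x| <= R.\<close>

definition \<epsilon> :: "real \<Rightarrow> nat \<Rightarrow> real" where
  "\<epsilon> R n = \<bar>\<rho> (n + N) - \<rho> n\<bar> + R * \<bar>1 / a (n + N) - 1 / a n\<bar> + \<bar>b (n + N) / a (n + N) - b n / a n\<bar>"

lemma \<epsilon>_summable: "summable (\<epsilon> R)"
  using \<rho>_variation_summable var1 var2 unfolding \<epsilon>_def finite_var_def
  by (intro summable_add summable_mult) auto

lemma \<epsilon>_nonneg: "R \<ge> 0 \<Longrightarrow> \<epsilon> R n \<ge> 0"
  by (simp add: \<epsilon>_def)

lemma s_diff_le:
  assumes "x \<in> {-R..R}"
  shows "\<bar>s n x - s (n + N) x\<bar> + \<bar>\<rho> (n + N) - \<rho> n\<bar> \<le> \<epsilon> R n"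
proof -
  have "s n x - s (n + N) x = - x * (1 / a (n + N) - 1 / a n) + (b (n + N) / a (n + N) - b n / a n)"
    by (simp add: diff_divide_distrib algebra_simps)
  then have "\<bar>s n x - s (n + N) x\<bar> \<le> \<bar>x\<bar> * \<bar>1 / a (n + N) - 1 / a n\<bar> + \<bar>b (n + N) / a (n + N) - b n / a n\<bar>"
    by (metis abs_minus_cancel abs_mult abs_triangle_ineq)
  also have "\<dots> \<le> R * \<bar>1 / a (n + N) - 1 / a n\<bar> + \<bar>b (n + N) / a (n + N) - b n / a n\<bar>"
    using assms by (intro add_right_mono mult_right_mono) auto
  finally show ?thesis by (simp add: \<epsilon>_def)
qed

lemma V_growth:
  assumes "R \<ge> 0"
  obtains K where "K \<ge> 1" "\<And>n x. x \<in> {-R..R} \<Longrightarrow> V (Suc n) x \<le> K * V n x"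
proof -
  obtain B where B: "B > 1" "\<And>n. \<rho> n \<le> B" "\<And>n. \<bar>b n / a n\<bar> \<le> B" "\<And>n. 1 / a n \<le> B" using coefficient_bounds by metis
  define T where "T = R * B + B"
  have T: "T \<ge> B" "T \<ge> 0" using B assms by (auto simp: T_def)
  have "V (Suc n) x \<le> (2 * T\<^sup>2 + 1) * V n x" if x: "x \<in> {-R..R}" for n x
  proof -
    have "s n x = x * (1 / a n) - b n / a n" by (simp add: diff_divide_distrib)
    then have "\<bar>s n x\<bar> \<le> \<bar>x\<bar> * (1 / a n) + \<bar>b n / a n\<bar>"
      using a_pos[of n] abs_triangle_ineq4[of "x * (1 / a n)" "b n / a n"] by (simp add: abs_mult)
    also have "\<dots> \<le> R * B + B"
      using x B(3)[of n] B(4)[of n] a_pos[of n] assms by (intro add_mono mult_mono) auto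
    finally have s: "\<bar>s n x\<bar> \<le> T" by (simp add: T_def)
    have \<rho>: "\<bar>\<rho> n\<bar> \<le> T" using B(2)[of n] T a_pos[of n] a_pos[of "n - 1"] by (simp add: abs_divide)
    have "\<bar>p (Suc n) x\<bar> \<le> \<bar>s n x\<bar> * \<bar>p n x\<bar> + \<bar>\<rho> n\<bar> * \<bar>pm n x\<bar>"
      unfolding p_Suc abs_mult[symmetric] by (rule abs_triangle_ineq4)
    also have "\<dots> \<le> T * \<bar>p n x\<bar> + T * \<bar>pm n x\<bar>"
      using s \<rho> by (intro add_mono mult_right_mono) auto
    finally have "\<bar>p (Suc n) x\<bar> \<le> T * (\<bar>p n x\<bar> + \<bar>pm n x\<bar>)" by (simp only: distrib_left)
    then have "\<bar>p (Suc n) x\<bar>\<^sup>2 \<le> (T * (\<bar>p n x\<bar> + \<bar>pm n x\<bar>))\<^sup>2" by (intro power_mono) auto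
    also have "\<dots> = T\<^sup>2 * (\<bar>p n x\<bar> + \<bar>pm n x\<bar>)\<^sup>2" by (simp add: power_mult_distrib)
    also have "\<dots> \<le> T\<^sup>2 * (2 * V n x)"
    proof (rule mult_left_mono)
      show "(\<bar>p n x\<bar> + \<bar>pm n x\<bar>)\<^sup>2 \<le> 2 * V n x"
        using zero_le_power2[of "\<bar>p n x\<bar> - \<bar>pm n x\<bar>"] by (simp add: V_def power2_sum power2_diff)
    qed simp
    finally have "(p (Suc n) x)\<^sup>2 \<le> 2 * T\<^sup>2 * V n x" by (simp del: orthp.simps add: mult_ac)
    moreover have "(2 * T\<^sup>2 + 1) * V n x = 2 * T\<^sup>2 * V n x + V n x"
      by (simp add: distrib_right)
    ultimately show ?thesis using V_ge(2)[of n x] unfolding V_def[of "Suc n"] pm_simps by linarith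
  qed
  then show ?thesis using that[of "2 * T\<^sup>2 + 1"] by auto
qed

lemma V_growth_N:
  assumes "R \<ge> 0"
  obtains K where "K \<ge> 1" "\<And>n x. x \<in> {-R..R} \<Longrightarrow> V (Suc n) x \<le> K * V n x" "\<And>n x. x \<in> {-R..R} \<Longrightarrow> V (n + N) x \<le> K * V n x"
proof -
  obtain K where K: "K \<ge> 1" "\<And>n x. x \<in> {-R..R} \<Longrightarrow> V (Suc n) x \<le> K * V n x" using V_growth[OF assms] by metis
  have m: "V (n + m) x \<le> K ^ m * V n x" if "x \<in> {-R..R}" for n m x
  proof (induction m)
    case (Suc m)
    have "V (n + Suc m) x \<le> K * V (n + m) x" using K(2)[OF that, of "n + m"] by simp
    also have "\<dots> \<le> K * (K ^ m * V n x)" using K Suc by (intro mult_left_mono) auto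
    finally show ?case by (simp add: mult.assoc)
  qed simp
  have "K \<le> K ^ N" using K N_pos power_increasing[of 1 N K] by simp
  then have "V (Suc n) x \<le> K ^ N * V n x" if "x \<in> {-R..R}" for n x
    using K(2)[OF that, of n] mult_right_mono[of K "K ^ N" "V n x"] V_pos[of n x] by linarith
  then show ?thesis using that[of "K ^ N"] m K by (auto simp: one_le_power)
qed

text \<open>The correction terms of \<open>turan_Suc\<close> are products of one entry of v_n with
  one of v_{n+N}; N transfer steps increase \<open>V\<close> by at most a constant factor, so both
  products are bounded by a multiple of \<open>V n x\<close>.\<close>

lemma turan_step:
  assumes "R \<ge> 0"
  obtains K where "K > 0" "\<And>n x. x \<in> {-R..R} \<Longrightarrow> V (Suc n) x \<le> K * V n x"
    "\<And>n x. x \<in> {-R..R} \<Longrightarrow> \<bar>D (Suc n) x - \<rho> n * D n x\<bar> \<le> K * \<epsilon> R n * V n x"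
proof -
  obtain K where K: "K \<ge> 1" "\<And>n x. x \<in> {-R..R} \<Longrightarrow> V (Suc n) x \<le> K * V n x" "\<And>n x. x \<in> {-R..R} \<Longrightarrow> V (n + N) x \<le> K * V n x"
    using V_growth_N[OF assms] by metis
  have "\<bar>D (Suc n) x - \<rho> n * D n x\<bar> \<le> (1 + K) * \<epsilon> R n * V n x" if x: "x \<in> {-R..R}" for n x
  proof -
    have prod: "\<bar>u * w\<bar> \<le> u\<^sup>2 + w\<^sup>2" for u w :: real
      using sum_squares_bound[of "\<bar>u\<bar>" "\<bar>w\<bar>"] mult_nonneg_nonneg[OF abs_ge_zero abs_ge_zero, of u w]
      unfolding abs_mult mult.assoc power2_abs by linarith
    have 1: "\<bar>p n x * p (n + N) x\<bar> \<le> (1 + K) * V n x"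
      using prod[of "p n x" "p (n + N) x"] K(3)[OF x, of n] V_ge(2)[of n x] V_ge(2)[of "n + N" x]
      unfolding distrib_right by linarith
    have 2: "\<bar>p n x * pm (n + N) x\<bar> \<le> (1 + K) * V n x"
      using prod[of "p n x" "pm (n + N) x"] K(3)[OF x, of n] V_ge(2)[of n x] V_ge(1)[of "n + N" x]
      unfolding distrib_right by linarith
    have "\<bar>D (Suc n) x - \<rho> n * D n x\<bar> = \<bar>(s n x - s (n + N) x) * (p n x * p (n + N) x) + (\<rho> (n + N) - \<rho> n) * (p n x * pm (n + N) x)\<bar>"
      unfolding turan_Suc[OF N_pos] by simp
    also have "\<dots> \<le> \<bar>s n x - s (n + N) x\<bar> * \<bar>p n x * p (n + N) x\<bar> + \<bar>\<rho> (n + N) - \<rho> n\<bar> * \<bar>p n x * pm (n + N) x\<bar>"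
      unfolding abs_mult[symmetric] by (rule abs_triangle_ineq)
    also have "\<dots> \<le> \<bar>s n x - s (n + N) x\<bar> * ((1 + K) * V n x) + \<bar>\<rho> (n + N) - \<rho> n\<bar> * ((1 + K) * V n x)"
      by (intro add_mono mult_left_mono 1 2) auto
    also have "\<dots> = (\<bar>s n x - s (n + N) x\<bar> + \<bar>\<rho> (n + N) - \<rho> n\<bar>) * ((1 + K) * V n x)"
      by (simp only: distrib_right)
    also have "\<dots> \<le> \<epsilon> R n * ((1 + K) * V n x)"
      using K(1) by (intro mult_right_mono s_diff_le x mult_nonneg_nonneg less_imp_le[OF V_pos]) auto
    finally show ?thesis by (simp only: mult_ac)
  qed
  moreover have "V (Suc n) x \<le> (1 + K) * V n x" if "x \<in> {-R..R}" for n x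
    using K(2)[OF that, of n] V_pos[of n x] unfolding distrib_right by linarith
  ultimately show ?thesis using that[of "1 + K"] K(1) by auto
qed

text \<open>x enters the coefficients only through x / a_n, which vanishes uniformly for |x| <= R.
  Hence one matrix \<open>F\<close> is the limit for all x.\<close>

lemma turan_wedge_limit:
  assumes "e > 0"
  obtains M where "\<And>k x. k \<ge> M \<Longrightarrow> x \<in> {-R..R} \<Longrightarrow>
    \<bar>D (k * N) x - wedge_form F (pm (k * N) x) (p (k * N) x)\<bar> \<le> e * V (k * N) x"
proof -
  \<comment> \<open>A limit along this filter is a limit that is uniform in the second component.\<close>
  let ?G = "sequentially \<times>\<^sub>F principal {-R..R}"
  let ?X = "\<lambda>k x. ordprod (\<lambda>j. transfer_mat (\<rho> (k * N + j)) ((b (k * N + j) - x) / a (k * N + j))) N"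
  have fst: "filterlim fst sequentially ?G" by (rule filterlim_fst)
  have rl: "((\<lambda>t. \<rho> (fst t * N + l)) \<longlongrightarrow> r l) ?G" if "l < N" for l
    by (rule filterlim_compose[OF lim_r[OF that] fst])
  have ql: "((\<lambda>t. (b (fst t * N + l) - snd t) / a (fst t * N + l)) \<longlongrightarrow> q l) ?G" if "l < N" for l
  proof -
    have 1: "((\<lambda>t. b (fst t * N + l) / a (fst t * N + l)) \<longlongrightarrow> q l) ?G"
      by (rule filterlim_compose[OF lim_q[OF that] fst])
    from filterlim_compose[OF filterlim_compose[OF lim_a filterlim_mult_add[of l]] fst]
    have 2: "((\<lambda>t. R * (1 / a (fst t * N + l))) \<longlongrightarrow> R * 0) ?G"
      by (intro tendsto_intros)
    have 3: "((\<lambda>t. snd t * (1 / a (fst t * N + l))) \<longlongrightarrow> 0) ?G"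
    proof (rule Lim_null_comparison)
      show "((\<lambda>t. R * (1 / a (fst t * N + l))) \<longlongrightarrow> 0) ?G" using 2 by simp
      show "\<forall>\<^sub>F t in ?G. norm (snd t * (1 / a (fst t * N + l))) \<le> R * (1 / a (fst t * N + l))"
      proof -
        have "\<forall>\<^sub>F t in ?G. snd t \<in> {-R..R}"
          using filterlim_snd[of "principal {-R..R}" sequentially] by (auto simp: filterlim_principal)
        then show ?thesis
        proof eventually_elim
          case (elim t)
          have "\<bar>snd t\<bar> * (1 / a (fst t * N + l)) \<le> R * (1 / a (fst t * N + l))"
            using elim a_pos[of "fst t * N + l"] by (intro mult_right_mono) auto
          then show ?case using a_pos[of "fst t * N + l"] by (simp add: abs_mult)
        qed
      qed
    qed
    from tendsto_diff[OF 1 3] show ?thesis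
      by (simp add: diff_divide_distrib)
  qed
  have lim: "((\<lambda>t. ?X (fst t) (snd t) $ i $ j) \<longlongrightarrow> F $ i $ j) ?G" for i j
    by (rule ordprod_tendsto) (use rl ql in auto)
  have "\<forall>\<^sub>F t in ?G. \<bar>?X (fst t) (snd t) $ i $ j - F $ i $ j\<bar> < e / 2" for i j
    using tendstoD[OF lim, of "e / 2" i j] assms by (simp add: dist_real_def)
  then have "\<forall>\<^sub>F t in ?G. \<forall>i j. \<bar>?X (fst t) (snd t) $ i $ j - F $ i $ j\<bar> < e / 2"
    by (intro eventually_all_finite)
  then obtain P Q where P: "eventually P sequentially" and Q: "eventually Q (principal {-R..R})"
    and PQ: "\<And>k x. P k \<Longrightarrow> Q x \<Longrightarrow> \<forall>i j. \<bar>?X k x $ i $ j - F $ i $ j\<bar> < e / 2"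
    unfolding eventually_prod_filter by force
  from P obtain M where M: "\<And>k. k \<ge> M \<Longrightarrow> P k" by (auto simp: eventually_sequentially)
  show ?thesis
  proof (rule that[of M])
    fix k x assume "k \<ge> M" "x \<in> {-R..R}"
    then have "\<bar>?X k x $ i $ j - F $ i $ j\<bar> \<le> e / 2" for i j
      using PQ[of k x] M Q by (force simp: eventually_principal intro: less_imp_le)
    \<comment> \<open>The perturbation bound doubles the entrywise error, hence the tolerance e / 2
      above.\<close>
    from wedge_form_perturb[OF this] 
    show "\<bar>D (k * N) x - wedge_form F (pm (k * N) x) (p (k * N) x)\<bar> \<le> e * V (k * N) x"
      unfolding turan_wedge_form[OF N_pos] V_def by simp
  qed
qed

end

context jacobi_periodic_limit
begin

text \<open>Only the residue class 0 is compared with the limit form. Definiteness then travels from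
  n to n + 1 through D_{n+1} = \<rho>_n D_n + o(V_n), with \<rho> bounded below, at the price of a
  smaller constant for each class.\<close>

lemma turan_definite_residue:
  assumes R: "R \<ge> 0"
  shows "\<exists>\<gamma>>0. \<exists>M. \<forall>k\<ge>M. \<forall>x\<in>{-R..R}. \<gamma> * V (k * N + i) x \<le> \<bar>D (k * N + i) x\<bar>"
proof (induction i)
  case 0
  obtain \<gamma> where \<gamma>: "\<gamma> > 0" "\<And>u w. \<gamma> * (u\<^sup>2 + w\<^sup>2) \<le> \<bar>wedge_form F u w\<bar>"
    using wedge_form_definite[OF discr_neg] by metis
  obtain M where M: "\<And>k x. k \<ge> M \<Longrightarrow> x \<in> {-R..R} \<Longrightarrow>
    \<bar>D (k * N) x - wedge_form F (pm (k * N) x) (p (k * N) x)\<bar> \<le> \<gamma> / 2 * V (k * N) x"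
    using turan_wedge_limit[OF half_gt_zero[OF \<gamma>(1)]] by blast
  have "\<gamma> / 2 * V (k * N) x \<le> \<bar>D (k * N) x\<bar>" if "k \<ge> M" "x \<in> {-R..R}" for k x
    using M[OF that] \<gamma>(2)[of "pm (k * N) x" "p (k * N) x"] unfolding V_def[symmetric] by linarith
  then show ?case using \<gamma>(1) by (intro exI[of _ "\<gamma> / 2"] conjI exI[of _ M]) auto
next
  case (Suc i)
  then obtain \<gamma> M where \<gamma>: "\<gamma> > 0" and M: "\<And>k x. k \<ge> M \<Longrightarrow> x \<in> {-R..R} \<Longrightarrow> \<gamma> * V (k * N + i) x \<le> \<bar>D (k * N + i) x\<bar>"
    by blast
  obtain K where K: "K > 0" "\<And>n x. x \<in> {-R..R} \<Longrightarrow> V (Suc n) x \<le> K * V n x"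
    "\<And>n x. x \<in> {-R..R} \<Longrightarrow> \<bar>D (Suc n) x - \<rho> n * D n x\<bar> \<le> K * \<epsilon> R n * V n x"
    by (rule turan_step[OF R]) (rule that)
  obtain B where B: "B > 1" "\<And>n. 1 / B \<le> \<rho> n" using coefficient_bounds by metis
  \<comment> \<open>The main term is at least (\<gamma> / B) V_n = 2 \<delta> V_n, and an error of
    at most \<delta> V_n leaves \<delta> V_n. The later division by K replaces V_n by
    V_{n+1}.\<close>
  define \<delta> where "\<delta> = \<gamma> / (2 * B)"
  have \<delta>: "\<delta> > 0" using \<gamma> B by (simp add: \<delta>_def)
  have "(\<lambda>n. K * \<epsilon> R n) \<longlonglongrightarrow> K * 0"
    by (intro tendsto_intros summable_LIMSEQ_zero \<epsilon>_summable)
  then have "\<forall>\<^sub>F n in sequentially. K * \<epsilon> R n < \<delta>" using \<delta> by (intro order_tendstoD) auto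
  from eventually_compose_filterlim[OF this filterlim_mult_add[of i]] obtain M'
    where M': "\<And>k. k \<ge> M' \<Longrightarrow> K * \<epsilon> R (k * N + i) < \<delta>" by (auto simp: eventually_sequentially)
  have "\<delta> / K * V (k * N + Suc i) x \<le> \<bar>D (k * N + Suc i) x\<bar>" if k: "k \<ge> max M M'" and x: "x \<in> {-R..R}" for k x
  proof -
    let ?n = "k * N + i"
    have Vp: "V ?n x > 0" by (rule V_pos)
    have "\<rho> ?n * \<bar>D ?n x\<bar> \<ge> 1 / B * (\<gamma> * V ?n x)"
      using B M[of k x] k x Vp \<gamma> by (intro mult_mono) (auto intro: divide_nonneg_nonneg less_imp_le[OF a_pos])
    also have "1 / B * (\<gamma> * V ?n x) = 2 * \<delta> * V ?n x" using B by (simp add: \<delta>_def)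
    finally have 1: "2 * \<delta> * V ?n x \<le> \<rho> ?n * \<bar>D ?n x\<bar>" .
    have "\<rho> ?n * \<bar>D ?n x\<bar> = \<bar>\<rho> ?n * D ?n x\<bar>"
      using a_pos[of "?n - 1"] a_pos[of ?n] by (simp add: abs_mult)
    moreover have "\<bar>D (Suc ?n) x - \<rho> ?n * D ?n x\<bar> \<le> \<delta> * V ?n x"
      using M'[of k] k Vp by (intro order_trans[OF K(3)[OF x]] mult_right_mono) auto
    moreover have "d \<le> \<bar>y\<bar>" if "2 * d \<le> \<bar>z\<bar>" "\<bar>y - z\<bar> \<le> d" for d y z :: real
      using that by linarith
    ultimately have "\<delta> * V ?n x \<le> \<bar>D (Suc ?n) x\<bar>" using 1 unfolding mult.assoc by metis
    moreover have "\<delta> / K * V (Suc ?n) x \<le> \<delta> * V ?n x"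
      using mult_left_mono[OF K(2)[OF x, of ?n], of "\<delta> / K"] K(1) \<delta> by simp
    ultimately show ?thesis by simp
  qed
  then show ?case using \<delta> K(1) by (intro exI[of _ "\<delta> / K"] conjI exI[of _ "max M M'"]) auto
qed

lemma turan_definite:
  assumes R: "R \<ge> 0"
  obtains \<gamma> M where "\<gamma> > 0" "\<And>n x. n \<ge> M \<Longrightarrow> x \<in> {-R..R} \<Longrightarrow> \<gamma> * V n x \<le> \<bar>D n x\<bar>"
proof -
  from turan_definite_residue[OF R] obtain \<gamma> M where \<gamma>: "\<And>i. \<gamma> i > 0"
    and M: "\<And>i k x. k \<ge> M i \<Longrightarrow> x \<in> {-R..R} \<Longrightarrow> \<gamma> i * V (k * N + i) x \<le> \<bar>D (k * N + i) x\<bar>"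
    by metis
  define g where "g = Min (\<gamma> ` {..<N})"
  define L where "L = N * Max (M ` {..<N})"
  have "0 \<in> {..<N}" using N_pos by simp
  then have ne: "{..<N} \<noteq> {}" by blast
  have "g > 0" unfolding g_def using \<gamma> ne by simp
  moreover have "g * V n x \<le> \<bar>D n x\<bar>" if n: "n \<ge> L" and x: "x \<in> {-R..R}" for n x
  proof -
    have i: "n mod N < N" using N_pos by simp
    have "Max (M ` {..<N}) \<le> n div N"
      using n N_pos by (simp add: L_def less_eq_div_iff_mult_less_eq mult.commute)
    moreover have "M (n mod N) \<le> Max (M ` {..<N})" using i by (intro Max_ge) auto
    ultimately have "M (n mod N) \<le> n div N" by linarith
    from M[OF this x] have "\<gamma> (n mod N) * V n x \<le> \<bar>D n x\<bar>" by simp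
    moreover have "g \<le> \<gamma> (n mod N)" unfolding g_def using i by (intro Min_le) auto
    ultimately show ?thesis using mult_right_mono[of g "\<gamma> (n mod N)" "V n x"] V_pos[of n x] by linarith
  qed
  ultimately show ?thesis using that by blast
qed

lemma continuous_on_S: "continuous_on A (S n)"
  unfolding turan_def orthp_prev_def by (cases "n = 0") (auto intro!: continuous_intros)

lemma S_uniform_limit:
  assumes R: "R \<ge> 0"
  obtains g \<gamma> M where "uniform_limit {-R..R} S g sequentially" "\<gamma> > 0"
    "\<And>n x. n \<ge> M \<Longrightarrow> x \<in> {-R..R} \<Longrightarrow> \<gamma> \<le> \<bar>S n x\<bar>"
proof -
  obtain \<gamma> M where \<gamma>: "\<gamma> > 0" and M: "\<And>n x. n \<ge> M \<Longrightarrow> x \<in> {-R..R} \<Longrightarrow> \<gamma> * V n x \<le> \<bar>D n x\<bar>"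
    by (rule turan_definite[OF R]) (rule that)
  obtain K where K: "K > 0" and "\<And>n x. x \<in> {-R..R} \<Longrightarrow> V (Suc n) x \<le> K * V n x"
    and KD: "\<And>n x. x \<in> {-R..R} \<Longrightarrow> \<bar>D (Suc n) x - \<rho> n * D n x\<bar> \<le> K * \<epsilon> R n * V n x"
    by (rule turan_step[OF R]) (rule that)
  obtain B where B: "B > 1" "\<And>n. 1 / B \<le> \<rho> n" using coefficient_bounds by metis
  \<comment> \<open>The first term is the deviation of the multiplier of S_n from 1. In the second,
    B bounds a_{n+N} / a_{n+N-1}, K comes from \<open>turan_step\<close>, and 1 / \<gamma> converts
    V_n into |D_n|. Since \<open>n - 1\<close> is truncated at 0, the steps are compared from index
    1 on.\<close>
  define e where "e n = \<bar>c n / c (n - 1) - 1\<bar> + (B * K / \<gamma>) * \<epsilon> R n" for n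
  have Dnz: "D n x \<noteq> 0" if "n \<ge> M" "x \<in> {-R..R}" for n x
    using M[OF that] mult_pos_pos[OF \<gamma> V_pos[of n x]] by auto
  show ?thesis
  proof (rule uniform_limit_multiplicative_steps[of "{-R..R}" S "max M 1" e])
    show "continuous_on {-R..R} (S n)" for n by (rule continuous_on_S)
    show "S n x \<noteq> 0" if "n \<ge> max M 1" "x \<in> {-R..R}" for n x
      using Dnz[of n x] that by simp
    have "summable (\<lambda>n. \<bar>c n / c (n - 1) - 1\<bar>)"
      using step_ratio_summable summable_Suc_iff[of "\<lambda>n. \<bar>c n / c (n - 1) - 1\<bar>"] by simp
    then show "summable e" unfolding e_def by (intro summable_add summable_mult \<epsilon>_summable)
    show "e n \<ge> 0" for n
      unfolding e_def using B K \<gamma> \<epsilon>_nonneg[OF R] by (intro add_nonneg_nonneg mult_nonneg_nonneg divide_nonneg_pos) auto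
    fix n x assume n: "n \<ge> max M 1" and x: "x \<in> {-R..R}"
    then obtain m where m: "n = Suc m" by (cases n) auto
    define A where "A = a (n + N)"
    define A' where "A' = a (n + N - 1)"
    have A: "A > 0" "A' > 0" using a_pos by (auto simp: A_def A'_def)
    have AA: "A \<le> B * A'"
    proof -
      have "1 / B \<le> A' / A" using B(2)[of "n + N"] by (simp add: A_def A'_def)
      then show ?thesis using A B by (simp add: field_simps)
    qed
    have ratio: "A * \<rho> n = (c n / c (n - 1)) * A'"
      using m a_pos[of m] a_pos[of "Suc m"] a_pos[of "m + N"] by (simp add: A_def A'_def)
    have split: "(k - 1) * (A' * d) + A * (d' - t * d) = A * d' - A' * d + (k * A' - A * t) * d" for k d d' t
      by (simp add: algebra_simps)
    have S: "S (Suc n) x = A * D (Suc n) x" "S n x = A' * D n x"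
      by (simp_all add: A_def A'_def)
    have "S (Suc n) x - S n x = (c n / c (n - 1) - 1) * S n x + A * (D (Suc n) x - \<rho> n * D n x)"
      unfolding S split ratio by simp
    then have "\<bar>S (Suc n) x - S n x\<bar> \<le> \<bar>c n / c (n - 1) - 1\<bar> * \<bar>S n x\<bar> + A * \<bar>D (Suc n) x - \<rho> n * D n x\<bar>"
      using A abs_triangle_ineq[of "(c n / c (n - 1) - 1) * S n x" "A * (D (Suc n) x - \<rho> n * D n x)"]
      by (simp only: abs_mult abs_of_pos)
    also have "A * \<bar>D (Suc n) x - \<rho> n * D n x\<bar> \<le> (B * K / \<gamma>) * \<epsilon> R n * \<bar>S n x\<bar>"
    proof -
      have Vle: "V n x \<le> \<bar>D n x\<bar> / \<gamma>" using M[of n x] n x \<gamma> by (simp add: field_simps)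
      have "A * \<bar>D (Suc n) x - \<rho> n * D n x\<bar> \<le> (B * A') * (K * \<epsilon> R n * V n x)"
        using A B AA KD[OF x, of n] by (intro mult_mono) auto
      also have "\<dots> \<le> (B * A') * (K * \<epsilon> R n * (\<bar>D n x\<bar> / \<gamma>))"
        using A B K \<epsilon>_nonneg[OF R] Vle by (intro mult_left_mono mult_nonneg_nonneg) auto
      also have "\<dots> = (B * K / \<gamma>) * \<epsilon> R n * \<bar>S n x\<bar>"
        using A by (simp add: abs_mult A'_def)
      finally show ?thesis .
    qed
    finally show "\<bar>S (Suc n) x - S n x\<bar> \<le> e n * \<bar>S n x\<bar>"
      by (simp add: e_def distrib_right)
  qed (simp, rule that)
qed

text \<open>A pointwise limit, so that a single function on the line agrees with the uniform limits
  on all intervals [-R, R].\<close>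

definition g :: "real \<Rightarrow> real" where "g x = lim (\<lambda>n. S n x)"

lemma S_uniform_limit_g:
  assumes R: "R \<ge> 0"
  shows "uniform_limit {-R..R} S g sequentially"
proof -
  obtain h \<gamma> M where h: "uniform_limit {-R..R} S h sequentially" and "\<gamma> > 0"
    "\<And>n x. n \<ge> M \<Longrightarrow> x \<in> {-R..R} \<Longrightarrow> \<gamma> \<le> \<bar>S n x\<bar>"
    by (rule S_uniform_limit[OF R]) (rule that)
  have "h x = g x" if "x \<in> {-R..R}" for x
    using tendsto_uniform_limitI[OF h that] by (simp add: g_def limI)
  then show ?thesis using h uniform_limit_cong'[of "{-R..R}" S S h g sequentially] by blast
qed

lemma S_tendsto_g: "(\<lambda>n. S n x) \<longlonglongrightarrow> g x"
  by (rule tendsto_uniform_limitI[OF S_uniform_limit_g[of "\<bar>x\<bar>"]]) auto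

lemma g_nz: "g x \<noteq> 0"
proof -
  obtain h \<gamma> M where "uniform_limit {-\<bar>x\<bar>..\<bar>x\<bar>} S h sequentially" and \<gamma>: "\<gamma> > 0"
    "\<And>n y. n \<ge> M \<Longrightarrow> y \<in> {-\<bar>x\<bar>..\<bar>x\<bar>} \<Longrightarrow> \<gamma> \<le> \<bar>S n y\<bar>"
    by (rule S_uniform_limit[OF abs_ge_zero[of x]]) (rule that)
  have "\<gamma> \<le> \<bar>g x\<bar>"
    by (rule LIMSEQ_le_const[OF tendsto_rabs[OF S_tendsto_g]]) (intro exI[of _ M] allI impI \<gamma>(2), auto)
  then show ?thesis using \<gamma>(1) by auto
qed

lemma continuous_g: "continuous_on UNIV g"
proof -
  have "isCont g x" for x
  proof -
    have "continuous_on {-(\<bar>x\<bar> + 1)..\<bar>x\<bar> + 1} g"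
      by (rule uniform_limit_theorem[OF always_eventually[OF allI[OF continuous_on_S]] S_uniform_limit_g]) auto
    then show ?thesis by (rule continuous_on_interior) (auto simp: interior_atLeastAtMost_real)
  qed
  then show ?thesis by (simp add: continuous_at_imp_continuous_on)
qed

end

subsection \<open>The density of the orthogonality measure\<close>

context jacobi_periodic_limit
begin

definition "weight x = sqrt (- discr F) / (2 * pi * \<bar>g x\<bar>)"

text \<open>\<tau> is the root t of the quadratic \<open>wedge_form X 1 t\<close> in the upper half
  plane; the absolute value in its imaginary part selects this root whatever the sign of
  \<open>X$1$2\<close>. The other root is its conjugate, so the form splits into
  \<open>X$1$2\<close> times a squared modulus.\<close>

lemma wedge_form_factor:
  assumes "discr X < 0"
  defines "\<tau> \<equiv> Complex (- (X$1$1 - X$2$2) / (2 * X$1$2)) (sqrt (- discr X) / (2 * \<bar>X$1$2\<bar>))"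
  shows "X$1$2 \<noteq> 0" and "Im \<tau> > 0"
    and "\<bar>wedge_form X u w\<bar> = \<bar>X$1$2\<bar> * (norm (of_real w - \<tau> * of_real u))\<^sup>2"
proof -
  let ?A = "X$1$2" and ?B = "X$1$1 - X$2$2"
  show A: "?A \<noteq> 0"
  proof
    assume "?A = 0"
    then have "discr X = ?B\<^sup>2" by (simp add: discr_eq)
    then show False using assms(1) by simp
  qed
  show "Im \<tau> > 0" using A assms(1) by (simp add: \<tau>_def)
  have sq: "(sqrt (- discr X))\<^sup>2 = - discr X" using assms(1) by simp
  have "(norm (of_real w - \<tau> * of_real u))\<^sup>2 = (w + ?B / (2 * ?A) * u)\<^sup>2 + (sqrt (- discr X) / (2 * \<bar>?A\<bar>) * u)\<^sup>2"
  proof -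
    have "Re (of_real w - \<tau> * of_real u) = w + ?B / (2 * ?A) * u"
      by (simp add: \<tau>_def left_diff_distrib diff_divide_distrib)
    moreover have "Im (of_real w - \<tau> * of_real u) = - (sqrt (- discr X) / (2 * \<bar>?A\<bar>) * u)"
      by (simp add: \<tau>_def)
    ultimately show ?thesis by (simp only: cmod_power2 power2_minus)
  qed
  also have "(sqrt (- discr X) / (2 * \<bar>?A\<bar>) * u)\<^sup>2 = - discr X / (4 * ?A\<^sup>2) * u\<^sup>2"
    by (simp add: power_mult_distrib power_divide sq)
  finally have "?A * (norm (of_real w - \<tau> * of_real u))\<^sup>2 = ?A * ((w + ?B / (2 * ?A) * u)\<^sup>2 + - discr X / (4 * ?A\<^sup>2) * u\<^sup>2)"
    by simp
  also have "\<dots> = wedge_form X u w"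
    using A unfolding discr_eq wedge_form_def by (simp add: field_simps power2_eq_square)
  finally show "\<bar>wedge_form X u w\<bar> = \<bar>?A\<bar> * (norm (of_real w - \<tau> * of_real u))\<^sup>2"
    by (metis abs_mult abs_of_nonneg zero_le_power2)
qed

lemma wedge_form_relative_limit:
  assumes R: "R \<ge> 0" and e: "e > 0"
  obtains M where "\<And>k x. k \<ge> M \<Longrightarrow> x \<in> {-R..R} \<Longrightarrow>
    \<bar>wedge_form F (pm (k * N) x) (p (k * N) x) - D (k * N) x\<bar> \<le> e * \<bar>D (k * N) x\<bar>"
proof -
  obtain \<gamma> M where \<gamma>: "\<gamma> > 0" and M: "\<And>n x. n \<ge> M \<Longrightarrow> x \<in> {-R..R} \<Longrightarrow> \<gamma> * V n x \<le> \<bar>D n x\<bar>"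
    by (rule turan_definite[OF R]) (rule that)
  \<comment> \<open>Errors in \<open>turan_wedge_limit\<close> are relative to V, and V <= |D| /
    \<gamma>, so this tolerance becomes the relative error e.\<close>
  have "e * \<gamma> > 0" using e \<gamma> by simp
  then obtain M' where M': "\<And>k x. k \<ge> M' \<Longrightarrow> x \<in> {-R..R} \<Longrightarrow>
    \<bar>D (k * N) x - wedge_form F (pm (k * N) x) (p (k * N) x)\<bar> \<le> e * \<gamma> * V (k * N) x"
    by (rule turan_wedge_limit) (rule that)
  show ?thesis
  proof (rule that[of "max M M'"])
    fix k x assume k: "k \<ge> max M M'" and x: "x \<in> {-R..R}"
    have "k \<le> k * N" using N_pos by (cases N) auto
    then have "M \<le> k * N" using k by linarith
    from mult_left_mono[OF M[OF this x], of e] e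
    have "e * \<gamma> * V (k * N) x \<le> e * \<bar>D (k * N) x\<bar>" by (simp add: mult.assoc)
    moreover have "\<bar>D (k * N) x - wedge_form F (pm (k * N) x) (p (k * N) x)\<bar> \<le> e * \<gamma> * V (k * N) x"
      using M'[of k x] k x by simp
    ultimately show "\<bar>wedge_form F (pm (k * N) x) (p (k * N) x) - D (k * N) x\<bar> \<le> e * \<bar>D (k * N) x\<bar>"
      by (simp add: abs_minus_commute)
  qed
qed

text \<open>S along the indices kN with its form replaced by the limit form. Unlike S, it factors
  through a fixed \<tau>, which makes it comparable with Carmona's denominators.\<close>

definition "W k x = a (k * N + N - 1) * wedge_form F (pm (k * N) x) (p (k * N) x)"

lemma W_relative:
  assumes R: "R \<ge> 0" and e: "e > 0"
  obtains M where "\<And>k x. k \<ge> M \<Longrightarrow> x \<in> {-R..R} \<Longrightarrow> \<bar>W k x - S (k * N) x\<bar> \<le> e * \<bar>S (k * N) x\<bar>"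
proof -
  obtain M where M: "\<And>k x. k \<ge> M \<Longrightarrow> x \<in> {-R..R} \<Longrightarrow>
    \<bar>wedge_form F (pm (k * N) x) (p (k * N) x) - D (k * N) x\<bar> \<le> e * \<bar>D (k * N) x\<bar>"
    by (rule wedge_form_relative_limit[OF assms]) (rule that)
  show ?thesis
  proof (rule that[of M])
    fix k x assume "k \<ge> M" "x \<in> {-R..R}"
    from M[OF this] have "a (k * N + N - 1) * \<bar>wedge_form F (pm (k * N) x) (p (k * N) x) - D (k * N) x\<bar>
        \<le> a (k * N + N - 1) * (e * \<bar>D (k * N) x\<bar>)"
      by (rule mult_left_mono) (rule less_imp_le[OF a_pos])
    moreover have "W k x - S (k * N) x = a (k * N + N - 1) * (wedge_form F (pm (k * N) x) (p (k * N) x) - D (k * N) x)"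
      by (simp add: W_def right_diff_distrib)
    ultimately show "\<bar>W k x - S (k * N) x\<bar> \<le> e * \<bar>S (k * N) x\<bar>"
      using a_pos[of "k * N + N - 1"] by (simp add: abs_mult mult_ac)
  qed
qed

lemma S_kN_tendsto: "(\<lambda>k. S (k * N) x) \<longlonglongrightarrow> g x"
  using filterlim_compose[OF S_tendsto_g filterlim_mult_add[of 0]] by simp

lemma W_tendsto: "(\<lambda>k. W k x) \<longlonglongrightarrow> g x"
proof -
  have "(\<lambda>k. (W k x - S (k * N) x) / S (k * N) x) \<longlonglongrightarrow> 0"
  proof (rule LIMSEQ_I)
    fix e :: real assume e: "e > 0"
    then have "e / 2 > 0" by simp
    then obtain M where M: "\<And>k y. k \<ge> M \<Longrightarrow> y \<in> {-\<bar>x\<bar>..\<bar>x\<bar>} \<Longrightarrow> \<bar>W k y - S (k * N) y\<bar> \<le> e / 2 * \<bar>S (k * N) y\<bar>"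
      by (rule W_relative[OF abs_ge_zero[of x]]) (rule that)
    have "norm ((W k x - S (k * N) x) / S (k * N) x - 0) < e" if "k \<ge> M" for k
    proof -
      have "\<bar>(W k x - S (k * N) x) / S (k * N) x\<bar> \<le> e / 2"
        using M[OF that, of x] e abs_ge_self[of x] abs_ge_minus_self[of x] by (cases "S (k * N) x = 0") (auto simp: abs_divide pos_divide_le_eq)
      then show ?thesis using e unfolding real_norm_def diff_0_right by linarith
    qed
    then show "\<exists>M. \<forall>k\<ge>M. norm ((W k x - S (k * N) x) / S (k * N) x - 0) < e" by blast
  qed
  from tendsto_add[OF tendsto_mult[OF this S_kN_tendsto[of x]] S_kN_tendsto[of x]]
  have "(\<lambda>k. (W k x - S (k * N) x) / S (k * N) x * S (k * N) x + S (k * N) x) \<longlonglongrightarrow> g x" by simp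
  moreover have cancel: "(u - v) / v * v + v = u" if "v \<noteq> 0" for u v :: real
    using that by simp
  have "\<forall>\<^sub>F k in sequentially. S (k * N) x \<noteq> 0"
    using tendsto_imp_eventually_ne[OF S_kN_tendsto g_nz] .
  then have "\<forall>\<^sub>F k in sequentially. (W k x - S (k * N) x) / S (k * N) x * S (k * N) x + S (k * N) x = W k x"
    by eventually_elim (rule cancel)
  ultimately show ?thesis by (rule Lim_transform_eventually)
qed

lemma W_lower_bound:
  assumes R: "R \<ge> 0"
  obtains \<gamma> M where "\<gamma> > 0" "\<And>k x. k \<ge> M \<Longrightarrow> x \<in> {-R..R} \<Longrightarrow> \<gamma> \<le> \<bar>W k x\<bar>"
proof -
  obtain h \<gamma> M where "uniform_limit {-R..R} S h sequentially" and \<gamma>: "\<gamma> > 0"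
    and M: "\<And>n x. n \<ge> M \<Longrightarrow> x \<in> {-R..R} \<Longrightarrow> \<gamma> \<le> \<bar>S n x\<bar>"
    by (rule S_uniform_limit[OF R]) (rule that)
  obtain M' where M': "\<And>k x. k \<ge> M' \<Longrightarrow> x \<in> {-R..R} \<Longrightarrow> \<bar>W k x - S (k * N) x\<bar> \<le> 1/2 * \<bar>S (k * N) x\<bar>"
    by (rule W_relative[OF R half_gt_zero[OF zero_less_one]]) (rule that)
  show ?thesis
  proof (rule that[of "\<gamma> / 2" "max M M'"])
    fix k x assume k: "k \<ge> max M M'" and x: "x \<in> {-R..R}"
    have "k \<le> k * N" using N_pos by (cases N) auto
    then have "M \<le> k * N" using k by linarith
    from M[OF this x] M'[of k x] k x
    have "\<gamma> \<le> \<bar>S (k * N) x\<bar>" "\<bar>W k x - S (k * N) x\<bar> \<le> 1/2 * \<bar>S (k * N) x\<bar>" by simp_all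
    moreover have "\<gamma> / 2 \<le> \<bar>u\<bar>" if "\<gamma> \<le> \<bar>v\<bar>" "\<bar>u - v\<bar> \<le> 1/2 * \<bar>v\<bar>" for u v :: real
      using that by linarith
    ultimately show "\<gamma> / 2 \<le> \<bar>W k x\<bar>" by blast
  qed (use \<gamma> in simp)
qed

theorem weight_is_orth_measure: "is_orth_measure a b (density lborel (\<lambda>x. ennreal (weight x)))"
proof -
  define \<tau> where "\<tau> = Complex (- (F$1$1 - F$2$2) / (2 * F$1$2)) (sqrt (- discr F) / (2 * \<bar>F$1$2\<bar>))"
  note fac = wedge_form_factor[OF discr_neg, folded \<tau>_def]
  \<comment> \<open>Chosen so that (p_{m k}, p_{m k + 1}) is the vector at index (k + 1) N. Starting
    from \<open>Suc k\<close> keeps the subtraction exact.\<close>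
  define m where "m k = Suc k * N - 1" for k
  have Sm: "Suc (m k) = Suc k * N" for k using N_pos by (simp add: m_def)
  define w where "w k = carmona_density (m k) \<tau>" for k
  \<comment> \<open>Carmona's density contains a_m but \<open>W\<close> contains a_{m+N}; their
    quotient is the factor \<open>c (m k)\<close>, which tends to 1. The factor |F_12| cancels
    between Im \<tau> and the factorised form.\<close>
  have w_eq: "w k x = sqrt (- discr F) / (2 * pi) * (c (m k) / \<bar>W (Suc k) x\<bar>)" for k x
  proof -
    define Q where "Q = (norm (of_real (p (Suc (m k)) x) - \<tau> * of_real (p (m k) x)))\<^sup>2"
    have "pm (Suc k * N) x = p (m k) x" "p (Suc k * N) x = p (Suc (m k)) x"
      unfolding Sm[symmetric] by (simp_all del: orthp.simps)
    then have wf: "\<bar>wedge_form F (pm (Suc k * N) x) (p (Suc k * N) x)\<bar> = \<bar>F$1$2\<bar> * Q"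
      unfolding fac(3) Q_def by simp
    have "Suc k * N + N - 1 = m k + N" using N_pos by (simp add: m_def)
    then have W: "\<bar>W (Suc k) x\<bar> = a (m k + N) * (\<bar>F$1$2\<bar> * Q)"
      unfolding W_def abs_mult wf using a_pos[of "m k + N"] by simp
    have "w k x = Im \<tau> / (pi * a (m k) * Q)"
      unfolding w_def carmona_density_def[OF fac(2)] Q_def ..
    also have "Im \<tau> = sqrt (- discr F) / (2 * \<bar>F$1$2\<bar>)" by (simp add: \<tau>_def)
    finally show ?thesis unfolding W using a_pos[of "m k + N"] by simp
  qed
  have wcont: "continuous_on UNIV (w k)" for k
    unfolding w_def by (rule continuous_carmona_density[OF fac(2)])
  show ?thesis
  proof (rule orth_measure_limit)
    show "w k \<in> borel_measurable borel" for k
      by (rule borel_measurable_continuous_onI[OF wcont])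
    show "w k x \<ge> 0" for k x
      unfolding w_def by (rule less_imp_le[OF carmona_density_pos[OF fac(2)]])
    show "(\<lambda>k. w k x) \<longlonglongrightarrow> weight x" for x
    proof -
      have "filterlim m sequentially sequentially"
        using N_pos by (intro filterlim_subseq strict_monoI) (auto simp: m_def intro!: diff_less_mono)
      from filterlim_compose[OF c_tendsto_1 this] have "(\<lambda>k. c (m k)) \<longlonglongrightarrow> 1" .
      moreover have "(\<lambda>k. W (Suc k) x) \<longlonglongrightarrow> g x"
        by (rule LIMSEQ_Suc[OF W_tendsto])
      ultimately have "(\<lambda>k. sqrt (- discr F) / (2 * pi) * (c (m k) / \<bar>W (Suc k) x\<bar>)) \<longlonglongrightarrow> sqrt (- discr F) / (2 * pi) * (1 / \<bar>g x\<bar>)"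
        using g_nz by (intro tendsto_intros) auto
      then show ?thesis unfolding w_eq weight_def by simp
    qed
    show "\<exists>B. \<forall>\<^sub>F k in sequentially. \<forall>x\<in>{-R..R}. w k x \<le> B" for R
    proof -
      obtain B where B: "B > 1" "\<And>n. c n \<le> B" using coefficient_bounds by metis
      obtain \<gamma> M where \<gamma>: "\<gamma> > 0" and M: "\<And>k x. k \<ge> M \<Longrightarrow> x \<in> {-\<bar>R\<bar>..\<bar>R\<bar>} \<Longrightarrow> \<gamma> \<le> \<bar>W k x\<bar>"
        by (rule W_lower_bound[OF abs_ge_zero[of R]]) (rule that)
      have "w k x \<le> sqrt (- discr F) / (2 * pi) * (B / \<gamma>)" if "k \<ge> M" "x \<in> {-R..R}" for k x
        unfolding w_eq using M[of "Suc k" x] that B(1) B(2)[of "m k"] \<gamma> a_pos[of "m k"] a_pos[of "m k + N"] discr_neg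
        by (intro mult_left_mono frac_le) auto
      then show ?thesis unfolding eventually_sequentially by blast
    qed
    show "\<forall>\<^sub>F k in sequentially. integrable lborel (\<lambda>x. w k x * (p i x * p j x)) \<and>
       (\<integral>x. w k x * (p i x * p j x) \<partial>lborel) = of_bool (i = j)" for i j
    proof (rule eventually_sequentiallyI[of "max i j"])
      fix k assume k: "k \<ge> max i j"
      have "Suc k \<le> Suc (m k)" unfolding Sm using N_pos by (cases N) auto
      then have "i \<le> m k" "j \<le> m k" using k by auto
      then show "integrable lborel (\<lambda>x. w k x * (p i x * p j x)) \<and>
       (\<integral>x. w k x * (p i x * p j x) \<partial>lborel) = of_bool (i = j)"
        unfolding w_def using carmona_integrable[OF fac(2), of i j "m k"] carmona_orthonormal[OF fac(2), of i "m k" j] by auto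
    qed
  qed
qed

end

theorem theorem1:
  fixes a b q r :: "nat \<Rightarrow> real" and N :: nat
  assumes a_pos: "\<And>n. a n > 0"
    and N_pos: "N \<ge> 1"
    and var1: "finite_var N (\<lambda>n. 1 / a n)"
    and var2: "finite_var N (\<lambda>n. b n / a n)"
    and var3: "finite_var 1 (\<lambda>n. a (n + N) / a n)"
    and div: "\<not> summable (\<lambda>n. 1 / a n)"
    and lim_a: "(\<lambda>n. 1 / a n) \<longlonglongrightarrow> 0"
    and lim_q: "\<And>i. i < N \<Longrightarrow> (\<lambda>n. b (n * N + i) / a (n * N + i)) \<longlonglongrightarrow> q i"
    and lim_r: "\<And>i. i < N \<Longrightarrow> (\<lambda>n. a (n * N + i - 1) / a (n * N + i)) \<longlonglongrightarrow> r i"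
    and r_pos: "\<And>i. i < N \<Longrightarrow> r i > 0"
    and discr_neg: "discr (ordprod (\<lambda>j. transfer_mat (r j) (q j)) N) < 0"
  shows "\<exists>g :: real \<Rightarrow> real.
     (\<forall>x. (\<lambda>n. a (n + N - 1) * turan a b N n x) \<longlonglongrightarrow> g x)
     \<and> continuous_on UNIV g
     \<and> (\<forall>x. g x \<noteq> 0)
     \<and> (\<exists>\<mu>. is_orth_measure a b \<mu>)
     \<and> (\<forall>\<mu>. is_orth_measure a b \<mu> \<longrightarrow>
          \<mu> = density lborel (\<lambda>x. ennreal
                 (sqrt (- discr (ordprod (\<lambda>j. transfer_mat (r j) (q j)) N))
                  / (2 * pi * \<bar>g x\<bar>))))"
proof -
  interpret jacobi_periodic_limit a b q r N
    by standard (fact assms)+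
  show ?thesis
    using S_tendsto_g continuous_g g_nz weight_is_orth_measure orth_measure_unique[OF _ weight_is_orth_measure div]
    unfolding weight_def by (intro exI[of _ g]) blast
qed

end
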